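(* Let $n\ge 4$ and let $e,f$ be two disjoint edges (edges with no common vertex) of the complete graph $K_n$. Let the edge weights of $K_n$ be independent with one common atomless law on $\mathbb{R}$, let $T$ be the almost surely unique minimum spanning tree, and put $p_2=\mathbf{P}(e\in T,\ f\in T)$ and $p_0=\mathbf{P}(e\in T)=\frac{2}{n}$. Then $$p_2<p_0^2=\frac{4}{n^2}.$$
   Context: By symmetry of $K_n$, every edge has the same inclusion probability $p_0=(n-1)/\binom n2=2/n$, and $p_2$ does not depend on the choice of the pair of disjoint edges. The law of $T$ does not depend on the choice of the common atomless weight law. *)

theory Defs
  imports "HOL-Probability.Probability"
begin

text \<open>Undirected simple graphs: edges are two-element vertex sets.\<close>

definition complete_graph_edges :: "nat \<Rightarrow> nat set set" where
  "complete_graph_edges n = {e. e \<subseteq> {..<n} \<and> card e = 2}"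

definition connected_graph :: "'a set \<Rightarrow> 'a set set \<Rightarrow> bool" where
  "connected_graph V F \<longleftrightarrow> (\<forall>u\<in>V. \<forall>v\<in>V. (u, v) \<in> {(x, y). {x, y} \<in> F}\<^sup>*)"

text \<open>A cycle is given by its distinct vertices in cyclic order, at least three of them.\<close>

definition is_cycle :: "'a set set \<Rightarrow> 'a list \<Rightarrow> bool" where
  "is_cycle F xs \<longleftrightarrow> 3 \<le> length xs \<and> distinct xs \<and>
     (\<forall>i<length xs. {xs ! i, xs ! (Suc i mod length xs)} \<in> F)"

text \<open>A spanning tree of \<open>(V, E)\<close> is represented by its edge set; its vertex set is \<open>V\<close>.\<close>

definition is_spanning_tree :: "'a set \<Rightarrow> 'a set set \<Rightarrow> 'a set set \<Rightarrow> bool" where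
  "is_spanning_tree V E T \<longleftrightarrow> T \<subseteq> E \<and> connected_graph V T \<and> \<not> (\<exists>xs. is_cycle T xs)"

definition is_min_spanning_tree ::
  "'a set \<Rightarrow> 'a set set \<Rightarrow> ('a set \<Rightarrow> real) \<Rightarrow> 'a set set \<Rightarrow> bool" where
  "is_min_spanning_tree V E w T \<longleftrightarrow> is_spanning_tree V E T \<and>
     (\<forall>S. is_spanning_tree V E S \<longrightarrow> sum w T \<le> sum w S)"

text \<open>Meaningful only for weights with a unique minimum spanning tree, hence almost surely for
  independent weights with a common atomless law.\<close>

definition complete_graph_mst :: "nat \<Rightarrow> (nat set \<Rightarrow> real) \<Rightarrow> nat set set" where
  "complete_graph_mst n w = (THE T. is_min_spanning_tree {..<n} (complete_graph_edges n) w T)"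

end

(* Only the order of the weights matters, and it is a uniform permutation of the edges, which
   Kruskal's algorithm turns into the minimum spanning tree. The edge and pair probabilities are
   symmetric, so p0 follows from the number n - 1 of tree edges, and p2 < 4/n^2 is equivalent to
   E[sum_v deg(v)^2] exceeding its value 5n - 11 + 6/n for a uniform spanning tree. The conditional
   expectation of sum_v deg(v)^2 under the uniform spanning tree, given the current Kruskal forest,
   is an explicit function of the degrees and component sizes. Along Kruskal's algorithm it is a
   submartingale: the drift reduces to 4/(a+b) <= 1/a + 1/b summed over triples of distinct
   components, which is strict once two of at least three components have different sizes, hence
   after the first edge when n >= 4. *)
theory Submission
  imports Defs "HOL-Combinatorics.Multiset_Permutations"
begin

section \<open>Connectivity\<close>

text \<open>The uniform spanning tree is the benchmark because it attains equality: a forest with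
  component sizes a_1, ..., a_m lies in n^(m-2) a_1 ... a_m spanning trees, so one edge is present
  with probability 2/n and two disjoint edges with probability exactly 4/n^2. Given a forest with m
  \<ge> 2 components C, the generating function of the degrees still to be added is proportional to
  the product over C of sum_{v in C} x_v, times (sum_v x_v)^(m-2). Hence the missing degree of v is
  a Bernoulli(1/a) variable, a the size of its component, plus an independent Binomial(m-2, 1/n)
  variable. Adding up second moments gives \<open>potential\<close>, with its 10, its 4 and its
  (m-2)(m+3). The proof itself works with this formula alone and never with a uniform spanning tree.
  The change of \<open>potential\<close> in one step depends on individual degrees, about which
  Kruskal's algorithm says little. It is linear in them, however, and the mean degree in a tree
  component of size a is 2(1 - 1/a), so after summation over all joining edges only component sizes
  remain.\<close>

definition edges_on :: "'a set \<Rightarrow> 'a set set" where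
  "edges_on V = {e. e \<subseteq> V \<and> card e = 2}"

text \<open>The component of \<open>u\<close>. Components are never collected into a partition: a
  sum over components is written as a sum over vertices with weight 1 / component size.\<close>

definition reach :: "'a set set \<Rightarrow> 'a \<Rightarrow> 'a set" where
  "reach F u = {v. (u, v) \<in> {(x, y). {x, y} \<in> F}\<^sup>*}"

lemma pair_in_edges_on [simp]: "{x, y} \<in> edges_on V \<longleftrightarrow> x \<in> V \<and> y \<in> V \<and> x \<noteq> y"
  by (auto simp: edges_on_def card_insert_if)

lemma edges_onE:
  assumes "g \<in> edges_on V"
  obtains x y where "g = {x, y}" "x \<in> V" "y \<in> V" "x \<noteq> y"
  using assms by (auto simp: edges_on_def card_2_iff)

lemma finite_edges_on [intro]: "finite V \<Longrightarrow> finite (edges_on V)"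
  by (simp add: edges_on_def)

lemma reach_refl [simp, intro]: "u \<in> reach F u"
  by (simp add: reach_def)

lemma reach_trans: "v \<in> reach F u \<Longrightarrow> w \<in> reach F v \<Longrightarrow> w \<in> reach F u"
  by (auto simp: reach_def)

lemma reach_sym: "v \<in> reach F u \<Longrightarrow> u \<in> reach F v"
proof -
  have "sym {(x, y). {x, y} \<in> F}" by (auto simp: sym_def insert_commute)
  then show "v \<in> reach F u \<Longrightarrow> u \<in> reach F v"
    unfolding reach_def by (auto dest: sym_rtrancl symD)
qed

lemma reach_commute: "v \<in> reach F u \<longleftrightarrow> u \<in> reach F v"
  using reach_sym by metis

lemma reach_eqI: "v \<in> reach F u \<Longrightarrow> reach F v = reach F u"
  by (auto intro: reach_trans reach_sym)

lemma reach_edge: "{x, y} \<in> F \<Longrightarrow> y \<in> reach F x"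
  by (auto simp: reach_def)

lemma reach_mono: "F \<subseteq> G \<Longrightarrow> reach F u \<subseteq> reach G u"
  unfolding reach_def using rtrancl_mono[of "{(x, y). {x, y} \<in> F}" "{(x, y). {x, y} \<in> G}"] by auto

lemma reach_least:
  assumes "u \<in> S" and "\<And>x y. x \<in> S \<Longrightarrow> {x, y} \<in> F \<Longrightarrow> y \<in> S"
  shows "reach F u \<subseteq> S"
proof
  fix v assume "v \<in> reach F u"
  then have "(u, v) \<in> {(x, y). {x, y} \<in> F}\<^sup>*" by (simp add: reach_def)
  then show "v \<in> S" by induction (use assms in auto)
qed

lemma reach_subset:
  assumes "F \<subseteq> edges_on V" "u \<in> V"
  shows "reach F u \<subseteq> V"
  using assms by (intro reach_least) (auto dest!: subsetD)

lemma reach_empty [simp]: "reach {} u = {u}"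
  by (simp add: reach_def)

text \<open>The right side contains \<open>u\<close> and is closed under the edges of the larger
  graph, which gives the first inclusion. If \<open>x\<close> and \<open>y\<close> are already
  connected, the two extra sets lie inside \<open>reach F u\<close>, so the formula also covers that
  case.\<close>

lemma reach_insert:
  "reach (insert {x, y} F) u =
     reach F u \<union> (if x \<in> reach F u then reach F y else {}) \<union> (if y \<in> reach F u then reach F x else {})"
    (is "?L = ?R")
proof
  show "?L \<subseteq> ?R"
  proof (rule reach_least)
    fix a b assume a: "a \<in> ?R" and "{a, b} \<in> insert {x, y} F"
    then consider "a = x" "b = y" | "a = y" "b = x" | "b \<in> reach F a"
      by (auto simp: doubleton_eq_iff intro: reach_edge)
    then show "b \<in> ?R"
      by cases (use a in \<open>auto split: if_splits intro: reach_trans reach_sym\<close>)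
  qed auto
  have sub: "reach F v \<subseteq> reach (insert {x, y} F) v" for v
    by (rule reach_mono) auto
  have "y \<in> reach (insert {x, y} F) x" "x \<in> reach (insert {x, y} F) y"
    by (auto intro!: reach_edge simp: insert_commute)
  then show "?R \<subseteq> ?L"
    using sub by (auto split: if_splits) (meson reach_trans subsetD)+
qed

lemma reach_edges_on:
  assumes v: "v \<in> V"
  shows "reach (edges_on V) v = V"
proof
  show "reach (edges_on V) v \<subseteq> V" using v by (intro reach_subset) auto
  show "V \<subseteq> reach (edges_on V) v"
  proof
    fix u assume "u \<in> V"
    with v show "u \<in> reach (edges_on V) v" by (cases "u = v") (simp_all add: reach_edge)
  qed
qed

lemma connected_graph_reach: "connected_graph V F \<longleftrightarrow> (\<forall>u\<in>V. V \<subseteq> reach F u)"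
  by (auto simp: connected_graph_def reach_def)

text \<open>For an edge \<open>g\<close> this is membership in the closure of \<open>F\<close> in
  the graphic matroid. Quantifying over both ends avoids choosing an orientation.\<close>

definition spanned :: "'a set set \<Rightarrow> 'a set \<Rightarrow> bool" where
  "spanned F g \<longleftrightarrow> (\<forall>x\<in>g. g \<subseteq> reach F x)"

lemma spanned_pair [simp]: "spanned F {x, y} \<longleftrightarrow> y \<in> reach F x"
  by (auto simp: spanned_def intro: reach_sym)

lemma spanned_mem: "g \<in> F \<Longrightarrow> g \<in> edges_on V \<Longrightarrow> spanned F g"
  by (elim edges_onE) (auto intro: reach_edge)

lemma spanned_cong: "reach F = reach G \<Longrightarrow> spanned F g = spanned G g"
  by (simp add: spanned_def)

lemma reach_insert_spanned:
  assumes "spanned F {x, y}" shows "reach (insert {x, y} F) = reach F"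
proof
  fix u show "reach (insert {x, y} F) u = reach F u"
    using assms unfolding reach_insert
    by (auto intro: reach_trans reach_sym)
qed

section \<open>Kruskal's algorithm\<close>

definition kruskal_step :: "'a set set \<Rightarrow> 'a set \<Rightarrow> 'a set set" where
  "kruskal_step F g = (if spanned F g then F else insert g F)"

definition kruskal :: "'a set set \<Rightarrow> 'a set list \<Rightarrow> 'a set set" where
  "kruskal = foldl kruskal_step"

lemma kruskal_simps [simp]:
  "kruskal F [] = F"
  "kruskal F (g # gs) = kruskal (kruskal_step F g) gs"
  "kruskal F (gs @ [g]) = kruskal_step (kruskal F gs) g"
  by (simp_all add: kruskal_def)

lemma reach_kruskal_step: "reach (kruskal_step F {x, y}) = reach (insert {x, y} F)"
  using reach_insert_spanned[of F x y] by (auto simp: kruskal_step_def)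

text \<open>A rejected edge has its ends connected already, so the accepted edges have the same
  components as all edges read. The acceptance test therefore depends only on the set of edges
  read.\<close>

lemma reach_kruskal:
  assumes "set gs \<subseteq> edges_on V"
  shows "reach (kruskal {} gs) = reach (set gs)"
  using assms
proof (induction gs rule: rev_induct)
  case (snoc g gs)
  then obtain x y where g: "g = {x, y}" by (auto elim: edges_onE)
  have IH: "reach (kruskal {} gs) = reach (set gs)" using snoc by simp
  have "reach (insert g (kruskal {} gs)) = reach (insert g (set gs))"
    by (rule ext) (simp add: g reach_insert IH)
  then show ?case by (simp add: reach_kruskal_step g)
qed auto

text \<open>In increasing order the edges read before \<open>g\<close> are exactly the lighter ones.
  The right side no longer mentions the order of the list, so it can be compared with a description
  of the minimum spanning tree.\<close>

lemma kruskal_sorted: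
  fixes w :: "'a set \<Rightarrow> 'b::linorder"
  assumes "set gs \<subseteq> edges_on V" "sorted_wrt (\<lambda>a b. w a < w b) gs"
  shows "kruskal {} gs = {g \<in> set gs. \<not> spanned {h \<in> set gs. w h < w g} g}"
  using assms
proof (induction gs rule: rev_induct)
  case (snoc k gs)
  have less: "w h < w k" if "h \<in> set gs" for h
    using snoc.prems that by (auto simp: sorted_wrt_append)
  have old: "{h \<in> set (gs @ [k]). w h < w g} = {h \<in> set gs. w h < w g}" if "g \<in> set gs" for g
    using less[OF that] by auto
  have new: "{h \<in> set (gs @ [k]). w h < w k} = set gs" using less by auto
  have "spanned (kruskal {} gs) k = spanned (set gs) k"
    using snoc.prems by (intro spanned_cong reach_kruskal[of _ V]) auto
  moreover have "kruskal {} gs = {g \<in> set gs. \<not> spanned {h \<in> set gs. w h < w g} g}"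
    using snoc by (auto simp: sorted_wrt_append)
  moreover have "k \<notin> set gs" using less by auto
  moreover have "{g \<in> set (gs @ [k]). \<not> spanned {h \<in> set (gs @ [k]). w h < w g} g} =
     {g \<in> set gs. \<not> spanned {h \<in> set gs. w h < w g} g} \<union> (if spanned (set gs) k then {} else {k})"
    using old new by auto
  ultimately show ?case by (simp add: kruskal_step_def)
qed auto

section \<open>The drift of the potential\<close>

definition degree :: "'a set set \<Rightarrow> 'a \<Rightarrow> real" where
  "degree F v = real (card {u. {v, u} \<in> F})"

definition csize :: "'a set set \<Rightarrow> 'a \<Rightarrow> real" where
  "csize F v = real (card (reach F v))"

definition ncomp :: "'a set \<Rightarrow> 'a set set \<Rightarrow> real" where
  "ncomp V F = (\<Sum>v\<in>V. 1 / csize F v)"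

text \<open>A component of size a with degree sum 2(a - 1) has a - 1 edges, so each component is a
  tree. In this form acyclicity enters the drift computation directly and is easily carried through
  a merge.\<close>

definition forest_degrees :: "'a set \<Rightarrow> 'a set set \<Rightarrow> bool" where
  "forest_degrees V F \<longleftrightarrow> F \<subseteq> edges_on V \<and>
     (\<forall>v\<in>V. (\<Sum>u\<in>reach F v. degree F u) = 2 * (csize F v - 1))"

text \<open>For a forest \<open>F\<close> this is the expectation of the sum of the squared degrees of a uniform spanning tree
  conditioned to contain \<open>F\<close>; the sums over \<open>v\<close> of \<open>1 / csize F v\<close> and \<open>1 / (csize F v)\<^sup>2\<close> are the number of
  components and the sum of their reciprocal sizes.\<close>

definition potential :: "'a set \<Rightarrow> 'a set set \<Rightarrow> real" where
  "potential V F = (\<Sum>v\<in>V. (degree F v)\<^sup>2) + 10 * (ncomp V F - 1) - 4 * (\<Sum>v\<in>V. 1 / (csize F v)\<^sup>2)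
     - (ncomp V F - 2) * (ncomp V F + 3) / real (card V)"

context
  fixes V :: "'a set"
  assumes finV: "finite V"
begin

lemma finite_reach: "F \<subseteq> edges_on V \<Longrightarrow> v \<in> V \<Longrightarrow> finite (reach F v)"
  using reach_subset finV finite_subset by metis

lemma csize_pos: "F \<subseteq> edges_on V \<Longrightarrow> v \<in> V \<Longrightarrow> csize F v > 0"
  unfolding csize_def using finite_reach[of F v] by (auto simp: card_gt_0_iff intro: reach_refl)

lemma csize_cong: "v \<in> reach F u \<Longrightarrow> csize F v = csize F u"
  by (simp add: csize_def reach_eqI)

lemma csize_merge:
  assumes F: "F \<subseteq> edges_on V" and xy: "x \<in> V" "y \<in> V" "y \<notin> reach F x" and "v \<in> V"
  shows "csize (insert {x, y} F) v =
    (if v \<in> reach F x \<union> reach F y then csize F x + csize F y else csize F v)"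
proof -
  have "reach F x \<inter> reach F y = {}"
    using xy(3) by (auto intro: reach_trans reach_sym)
  then have c: "card (reach F x \<union> reach F y) = card (reach F x) + card (reach F y)"
    using finite_reach[OF F] xy by (simp add: card_Un_disjoint)
  have "reach (insert {x, y} F) v = (if v \<in> reach F x \<union> reach F y then reach F x \<union> reach F y else reach F v)"
  proof (cases "v \<in> reach F x")
    case True
    then have "reach F v = reach F x" by (rule reach_eqI)
    then show ?thesis using True xy(3) by (auto simp: reach_insert)
  next
    case False
    note vx = this
    show ?thesis
    proof (cases "v \<in> reach F y")
      case True
      then have "reach F v = reach F y" by (rule reach_eqI)
      then show ?thesis using True vx xy(3) reach_commute[of y F x] by (auto simp: reach_insert)
    next
      case False
      then show ?thesis using vx reach_commute[of v F] by (auto simp: reach_insert)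
    qed
  qed
  then show ?thesis using c by (simp add: csize_def)
qed

text \<open>Blocks of a and b vertices become one block of a + b vertices, and all other sizes stay.
  The cases \<phi> = 1/t and \<phi> = 1/t^2 update the two size statistics in
  \<open>potential\<close>.\<close>

lemma sum_csize_merge:
  fixes \<phi> :: "real \<Rightarrow> real"
  assumes F: "F \<subseteq> edges_on V" and xy: "x \<in> V" "y \<in> V" "y \<notin> reach F x"
  defines "a \<equiv> csize F x" and "b \<equiv> csize F y"
  shows "(\<Sum>v\<in>V. \<phi> (csize (insert {x, y} F) v)) =
    (\<Sum>v\<in>V. \<phi> (csize F v)) - a * \<phi> a - b * \<phi> b + (a + b) * \<phi> (a + b)"
proof -
  let ?A = "reach F x" and ?B = "reach F y"
  have sub: "?A \<subseteq> V" "?B \<subseteq> V" using reach_subset[OF F] xy by auto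
  have dis: "?A \<inter> ?B = {}" using xy(3) by (auto intro: reach_trans reach_sym)
  have split: "(\<Sum>v\<in>V. \<psi> v) = (\<Sum>v\<in>V - (?A \<union> ?B). \<psi> v) + (\<Sum>v\<in>?A. \<psi> v) + (\<Sum>v\<in>?B. \<psi> v)"
    for \<psi> :: "'a \<Rightarrow> real"
  proof -
    have "(\<Sum>v\<in>?A \<union> ?B. \<psi> v) = (\<Sum>v\<in>?A. \<psi> v) + (\<Sum>v\<in>?B. \<psi> v)"
      using dis finite_reach[OF F] xy by (intro sum.union_disjoint) auto
    moreover have "(\<Sum>v\<in>V. \<psi> v) = (\<Sum>v\<in>V - (?A \<union> ?B). \<psi> v) + (\<Sum>v\<in>?A \<union> ?B. \<psi> v)"
      using sub finV by (intro sum.subset_diff) auto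
    ultimately show ?thesis by simp
  qed
  note m = csize_merge[OF F xy]
  have "(\<Sum>v\<in>?A. \<phi> (csize (insert {x, y} F) v)) = a * \<phi> (a + b)"
       "(\<Sum>v\<in>?B. \<phi> (csize (insert {x, y} F) v)) = b * \<phi> (a + b)"
    using sub by (auto simp: m subset_iff a_def b_def) (simp_all add: csize_def)
  moreover have "(\<Sum>v\<in>?A. \<phi> (csize F v)) = a * \<phi> a" "(\<Sum>v\<in>?B. \<phi> (csize F v)) = b * \<phi> b"
    by (simp_all add: csize_cong a_def b_def) (simp_all add: csize_def)
  moreover have "(\<Sum>v\<in>V - (?A \<union> ?B). \<phi> (csize (insert {x, y} F) v)) = (\<Sum>v\<in>V - (?A \<union> ?B). \<phi> (csize F v))"
    by (intro sum.cong) (auto simp: m)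
  ultimately show ?thesis
    unfolding split[of "\<lambda>v. \<phi> (csize (insert {x, y} F) v)"] split[of "\<lambda>v. \<phi> (csize F v)"]
    by (simp add: algebra_simps)
qed

lemma degree_insert:
  assumes F: "F \<subseteq> edges_on V" and xy: "x \<in> V" "y \<in> V" "x \<noteq> y" "{x, y} \<notin> F"
  shows "degree (insert {x, y} F) v = degree F v + (if v = x then 1 else 0) + (if v = y then 1 else 0)"
proof -
  have "finite {u. {v, u} \<in> F}"
    using F by (intro finite_subset[OF _ finV]) (auto dest!: subsetD)
  moreover have "{u. {v, u} \<in> insert {x, y} F} = {u. {v, u} \<in> F} \<union> (if v = x then {y} else {}) \<union> (if v = y then {x} else {})"
    by (auto simp: doubleton_eq_iff)
  moreover have "{y, x} \<notin> F" using xy by (simp add: insert_commute)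
  ultimately show ?thesis using xy by (auto simp: degree_def)
qed

lemma forest_degrees_empty: "forest_degrees V {}"
  by (auto simp: forest_degrees_def csize_def degree_def)

text \<open>Each end of the new edge adds 1 on its own side: (2(a - 1) + 1) + (2(b - 1) + 1) = 2(a +
  b - 1).\<close>

lemma forest_degrees_insert:
  assumes fd: "forest_degrees V F" and xy: "x \<in> V" "y \<in> V" "y \<notin> reach F x"
  shows "forest_degrees V (insert {x, y} F)"
proof -
  have F: "F \<subseteq> edges_on V" using fd by (simp add: forest_degrees_def)
  have ne: "x \<noteq> y" "{x, y} \<notin> F" using xy by (auto dest: reach_edge)
  note d = degree_insert[OF F xy(1,2) ne]
  let ?A = "reach F x" and ?B = "reach F y" and ?G = "insert {x, y} F"
  have dis: "?A \<inter> ?B = {}" using xy(3) by (auto intro: reach_trans reach_sym)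
  have fin: "finite (reach F v)" if "v \<in> V" for v using that by (rule finite_reach[OF F])
  have "(\<Sum>u\<in>reach ?G v. degree ?G u) = 2 * (csize ?G v - 1)" if v: "v \<in> V" for v
  proof (cases "v \<in> ?A \<union> ?B")
    case True
    then have "reach ?G v = ?A \<union> ?B"
      using xy(3) reach_eqI[of v F] reach_commute[of _ F x] dis by (auto simp: reach_insert)
    moreover have "(\<Sum>u\<in>?A \<union> ?B. degree ?G u) = (\<Sum>u\<in>?A. degree ?G u) + (\<Sum>u\<in>?B. degree ?G u)"
      using dis fin xy by (intro sum.union_disjoint) auto
    moreover have "(\<Sum>u\<in>?A. degree ?G u) = 2 * (csize F x - 1) + 1"
      using fd xy fin[OF xy(1)] by (simp add: d sum.distrib forest_degrees_def)
    moreover have "(\<Sum>u\<in>?B. degree ?G u) = 2 * (csize F y - 1) + 1"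
      using fd xy fin[OF xy(2)] reach_commute[of x F y] by (simp add: d sum.distrib forest_degrees_def)
    ultimately show ?thesis using True csize_merge[OF F xy v] by auto
  next
    case False
    then have n: "x \<notin> reach F v" "y \<notin> reach F v" using reach_commute[of v F] by auto
    then have "reach ?G v = reach F v" by (simp add: reach_insert)
    moreover have "(\<Sum>u\<in>reach F v. degree ?G u) = (\<Sum>u\<in>reach F v. degree F u)"
      using n by (intro sum.cong) (auto simp: d)
    ultimately show ?thesis using fd v by (simp add: forest_degrees_def csize_def)
  qed
  then show ?thesis using F xy ne by (auto simp: forest_degrees_def)
qed

text \<open>A component of size \<open>a\<close> has degree sum \<open>2 (a - 1)\<close>, so against functions of the component size
  each degree may be replaced by its mean \<open>2 (1 - 1 / a)\<close>.\<close>

lemma sum_degree_weighted: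
  fixes \<phi> :: "real \<Rightarrow> real"
  assumes fd: "forest_degrees V F"
  shows "(\<Sum>v\<in>V. degree F v * \<phi> (csize F v)) = (\<Sum>v\<in>V. 2 * (1 - 1 / csize F v) * \<phi> (csize F v))"
proof -
  have F: "F \<subseteq> edges_on V" using fd by (simp add: forest_degrees_def)
  have pos: "csize F v > 0" if "v \<in> V" for v using that by (rule csize_pos[OF F])
  have rV: "reach F v = {u \<in> V. u \<in> reach F v}" if "v \<in> V" for v using reach_subset[OF F that] by auto
  \<comment> \<open>Each term is spread evenly over the component of \<open>v\<close>. After the
    sums are swapped, the degrees add up over the component of a fixed \<open>u\<close>, where
    \<open>csize\<close> is constant.\<close>
  have "(\<Sum>v\<in>V. degree F v * \<phi> (csize F v))
      = (\<Sum>v\<in>V. \<Sum>u\<in>reach F v. degree F v * \<phi> (csize F v) / csize F v)"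
    using pos by (intro sum.cong) (auto simp: csize_def)
  also have "\<dots> = (\<Sum>v\<in>V. \<Sum>u\<in>{u \<in> V. u \<in> reach F v}. degree F v * \<phi> (csize F v) / csize F v)"
    using rV by (intro sum.cong) auto
  also have "\<dots> = (\<Sum>u\<in>V. \<Sum>v\<in>{v \<in> V. u \<in> reach F v}. degree F v * \<phi> (csize F v) / csize F v)"
    using finV by (intro sum.swap_restrict) auto
  also have "\<dots> = (\<Sum>u\<in>V. \<Sum>v\<in>reach F u. degree F v * (\<phi> (csize F u) / csize F u))"
  proof (rule sum.cong[OF refl])
    fix u assume "u \<in> V"
    have "{v \<in> V. u \<in> reach F v} = reach F u"
      using rV[OF \<open>u \<in> V\<close>] reach_commute[of u F] by auto
    then show "(\<Sum>v\<in>{v \<in> V. u \<in> reach F v}. degree F v * \<phi> (csize F v) / csize F v)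
       = (\<Sum>v\<in>reach F u. degree F v * (\<phi> (csize F u) / csize F u))"
      by (auto intro!: sum.cong simp: csize_cong)
  qed
  also have "\<dots> = (\<Sum>u\<in>V. 2 * (csize F u - 1) * (\<phi> (csize F u) / csize F u))"
    using fd by (intro sum.cong refl) (simp only: forest_degrees_def flip: sum_distrib_right)
  also have "\<dots> = (\<Sum>u\<in>V. 2 * (1 - 1 / csize F u) * \<phi> (csize F u))"
  proof (intro sum.cong refl)
    fix u assume "u \<in> V"
    then show "2 * (csize F u - 1) * (\<phi> (csize F u) / csize F u) = 2 * (1 - 1 / csize F u) * \<phi> (csize F u)"
      using pos[of u] by (simp add: divide_simps)
  qed
  finally show ?thesis .
qed

text \<open>The -8 is the +2 from the two squares minus the 10 of the lost component. With m =
  \<open>ncomp V F\<close>, the last term is (m-2)(m+3) - (m-3)(m+2) = 2m, over the number of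
  vertices.\<close>

lemma potential_insert:
  assumes fd: "forest_degrees V F" and xy: "x \<in> V" "y \<in> V" "y \<notin> reach F x"
  shows "potential V (insert {x, y} F) - potential V F =
    2 * (degree F x + degree F y) - 8 + 4 * (1 / csize F x + 1 / csize F y - 1 / (csize F x + csize F y))
     + 2 * ncomp V F / real (card V)"
proof -
  let ?G = "insert {x, y} F"
  have F: "F \<subseteq> edges_on V" using fd by (simp add: forest_degrees_def)
  have ne: "x \<noteq> y" "{x, y} \<notin> F" using xy by (auto dest: reach_edge)
  note d = degree_insert[OF F xy(1,2) ne]
  have pos: "csize F x > 0" "csize F y > 0" using csize_pos[OF F] xy by auto
  have nV: "real (card V) > 0" using xy finV by (auto simp: card_gt_0_iff)
  have m: "ncomp V ?G = ncomp V F - 1"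
    unfolding ncomp_def sum_csize_merge[OF F xy, of "\<lambda>t. 1 / t"] using pos by simp
  have h: "(\<Sum>v\<in>V. 1 / (csize ?G v)\<^sup>2) = (\<Sum>v\<in>V. 1 / (csize F v)\<^sup>2)
      - 1 / csize F x - 1 / csize F y + 1 / (csize F x + csize F y)"
    unfolding sum_csize_merge[OF F xy, of "\<lambda>t. 1 / t\<^sup>2"] using pos by (simp add: power2_eq_square)
  have "(\<Sum>v\<in>V. (degree ?G v)\<^sup>2) = (\<Sum>v\<in>V. (degree F v)\<^sup>2 + (if v = x then 2 * degree F v + 1 else 0) + (if v = y then 2 * degree F v + 1 else 0))"
    using ne by (intro sum.cong) (auto simp: d power2_eq_square algebra_simps)
  also have "\<dots> = (\<Sum>v\<in>V. (degree F v)\<^sup>2) + (2 * degree F x + 1) + (2 * degree F y + 1)"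
    using xy finV by (simp add: sum.distrib)
  finally have q: "(\<Sum>v\<in>V. (degree ?G v)\<^sup>2) = (\<Sum>v\<in>V. (degree F v)\<^sup>2) + 2 * degree F x + 2 * degree F y + 2"
    by simp
  show ?thesis
    unfolding potential_def m h q using nV by (simp add: divide_simps) (simp add: algebra_simps)
qed

section \<open>Summing the drift over pairs and triples of vertices in distinct components\<close>

definition apart :: "'a set set \<Rightarrow> ('a \<times> 'a) set" where
  "apart F = {(x, y). x \<in> V \<and> y \<in> V \<and> y \<notin> reach F x}"

definition apart3 :: "'a set set \<Rightarrow> ('a \<times> 'a \<times> 'a) set" where
  "apart3 F = {(x, y, z). (x, y) \<in> apart F \<and> (x, z) \<in> apart F \<and> (y, z) \<in> apart F}"

lemma finite_apart: "finite (apart F)"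
  by (rule finite_subset[of _ "V \<times> V"]) (auto simp: apart_def finV)

lemma finite_apart3: "finite (apart3 F)"
  by (rule finite_subset[of _ "V \<times> V \<times> V"]) (auto simp: apart_def apart3_def finV)

lemma apart_sym: "(x, y) \<in> apart F \<longleftrightarrow> (y, x) \<in> apart F"
  by (auto simp: apart_def intro: reach_sym)

lemma sum_apart_swap: "(\<Sum>(x, y)\<in>apart F. \<psi> x y) = (\<Sum>(x, y)\<in>apart F. \<psi> y x)"
  by (rule sum.reindex_bij_witness[of _ prod.swap prod.swap]) (auto simp: apart_sym)

lemma sum_apart_fst:
  assumes F: "F \<subseteq> edges_on V"
  shows "(\<Sum>(x, y)\<in>apart F. \<psi> x) = (\<Sum>x\<in>V. \<psi> x * (real (card V) - csize F x))"
proof -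
  have "apart F = (SIGMA x:V. V - reach F x)" by (auto simp: apart_def)
  then have "(\<Sum>(x, y)\<in>apart F. \<psi> x) = (\<Sum>x\<in>V. \<Sum>y\<in>V - reach F x. \<psi> x)"
    using finV by (subst sum.Sigma) auto
  also have "\<dots> = (\<Sum>x\<in>V. \<psi> x * (real (card V) - csize F x))"
  proof (rule sum.cong[OF refl])
    fix x assume "x \<in> V"
    then have "reach F x \<subseteq> V" by (rule reach_subset[OF F])
    then have "real (card (V - reach F x)) = real (card V) - csize F x"
      using finV by (simp add: card_Diff_subset finite_subset of_nat_diff card_mono csize_def)
    then show "(\<Sum>y\<in>V - reach F x. \<psi> x) = \<psi> x * (real (card V) - csize F x)" by simp
  qed
  finally show ?thesis .
qed

text \<open>A vertex \<open>x\<close> occurs in \<open>card V - csize F x\<close> pairs, a weight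
  that depends on its component size only, so its degree may be replaced by the mean 2(1 - 1/a).
  Then 2(deg x + deg y) - 8 becomes -4/a - 4/b and cancels the reciprocals in
  \<open>potential_insert\<close>, except for -4/(a + b).\<close>

lemma sum_potential_insert:
  assumes fd: "forest_degrees V F"
  shows "(\<Sum>(x, y)\<in>apart F. potential V (insert {x, y} F) - potential V F) =
    2 * (\<Sum>(x, y)\<in>apart F. ncomp V F / real (card V) - 2 / (csize F x + csize F y))"
proof -
  have F: "F \<subseteq> edges_on V" using fd by (simp add: forest_degrees_def)
  define \<psi> where "\<psi> = (\<lambda>x. degree F x - 2 * (1 - 1 / csize F x))"
  have "(\<Sum>(x, y)\<in>apart F. \<psi> x) = 0"
    using sum_degree_weighted[OF fd, of "\<lambda>t. real (card V) - t"]
    by (simp add: sum_apart_fst[OF F] \<psi>_def left_diff_distrib sum_subtractf)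
  moreover from this have "(\<Sum>(x, y)\<in>apart F. \<psi> y) = 0"
    using sum_apart_swap[of "\<lambda>x y. \<psi> x"] by simp
  moreover have "(\<Sum>(x, y)\<in>apart F. potential V (insert {x, y} F) - potential V F) =
    (\<Sum>(x, y)\<in>apart F. 2 * \<psi> x + 2 * \<psi> y + 2 * (ncomp V F / real (card V) - 2 / (csize F x + csize F y)))"
    by (intro sum.cong) (auto simp: apart_def potential_insert[OF fd] \<psi>_def)
  moreover have "(\<Sum>(x, y)\<in>apart F. 2 * f x + 2 * g y + 2 * h x y) =
      2 * (\<Sum>(x, y)\<in>apart F. f x) + 2 * (\<Sum>(x, y)\<in>apart F. g y) + 2 * (\<Sum>(x, y)\<in>apart F. h x y)"
    for f g :: "'a \<Rightarrow> real" and h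
    by (simp add: split_beta sum.distrib sum_distrib_left)
  ultimately show ?thesis by (simp only: mult_zero_right add_0)
qed

text \<open>Expanding \<open>ncomp\<close> as a sum over vertices \<open>z\<close>, the \<open>z\<close> in the components of \<open>x\<close> and \<open>y\<close> cancel, and on
  the remaining triples \<open>1 / csize F z\<close> may be symmetrised to \<open>(1 / csize F x + 1 / csize F y) / 2\<close>.\<close>

lemma sum_apart3:
  assumes F: "F \<subseteq> edges_on V"
  shows "real (card V) * (\<Sum>(x, y)\<in>apart F. ncomp V F / real (card V) - 2 / (csize F x + csize F y)) =
    (\<Sum>(x, y, z)\<in>apart3 F. (csize F x - csize F y)\<^sup>2 / (2 * csize F x * csize F y * (csize F x + csize F y)))"
proof -
  let ?s = "csize F"
  have pos: "?s v > 0" if "v \<in> V" for v using that by (rule csize_pos[OF F])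
  have one: "real (card V) * (ncomp V F / real (card V) - 2 / (?s x + ?s y)) =
      (\<Sum>z\<in>V - reach F x - reach F y. 1 / ?s z - 2 / (?s x + ?s y))"
    if "(x, y) \<in> apart F" for x y
  proof -
    let ?A = "reach F x" and ?B = "reach F y"
    from that have xy: "x \<in> V" "y \<in> V" "y \<notin> ?A" by (auto simp: apart_def)
    have dis: "?A \<inter> ?B = {}" using xy(3) by (auto intro: reach_trans reach_sym)
    have sub: "?A \<subseteq> V" "?B \<subseteq> V" using reach_subset[OF F] xy by auto
    have fin: "finite ?A" "finite ?B" using finite_reach[OF F] xy by auto
    let ?f = "\<lambda>z. 1 / ?s z - 2 / (?s x + ?s y)"
    have "real (card V) * (ncomp V F / real (card V) - 2 / (?s x + ?s y)) = (\<Sum>z\<in>V. ?f z)"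
      using xy finV by (auto simp: sum_subtractf ncomp_def right_diff_distrib card_gt_0_iff)
    also have "\<dots> = (\<Sum>z\<in>V - (?A \<union> ?B). ?f z) + (\<Sum>z\<in>?A \<union> ?B. ?f z)"
      using sub finV by (intro sum.subset_diff) auto
    also have "(\<Sum>z\<in>?A \<union> ?B. ?f z) = (\<Sum>z\<in>?A. ?f z) + (\<Sum>z\<in>?B. ?f z)"
      using dis fin by (intro sum.union_disjoint) auto
    also have "(\<Sum>z\<in>?A. ?f z) = ?s x * ?f x"
      by (simp add: csize_cong) (simp add: csize_def)
    also have "(\<Sum>z\<in>?B. ?f z) = ?s y * ?f y"
      by (simp add: csize_cong) (simp add: csize_def)
    \<comment> \<open>With sizes a and b this is a/a + b/b - 2(a + b)/(a + b).\<close>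
    also have "?s x * ?f x + ?s y * ?f y = 0"
      using pos[OF xy(1)] pos[OF xy(2)] by (simp add: divide_simps)
    finally show ?thesis by (simp add: Diff_eq Int_assoc)
  qed
  have A3: "(\<Sum>(x, y)\<in>apart F. \<Sum>z\<in>V - reach F x - reach F y. \<psi> x y z) = (\<Sum>(x, y, z)\<in>apart3 F. \<psi> x y z)"
    for \<psi> :: "'a \<Rightarrow> 'a \<Rightarrow> 'a \<Rightarrow> real"
  proof -
    have "(\<Sum>(x, y)\<in>apart F. \<Sum>z\<in>V - reach F x - reach F y. \<psi> x y z)
      = (\<Sum>p\<in>apart F. \<Sum>z\<in>V - reach F (fst p) - reach F (snd p). \<psi> (fst p) (snd p) z)"
      by (simp add: split_beta)
    also have "\<dots> = (\<Sum>(p, z)\<in>(SIGMA p:apart F. V - reach F (fst p) - reach F (snd p)). \<psi> (fst p) (snd p) z)"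
      using finV finite_apart by (intro sum.Sigma) auto
    also have "\<dots> = (\<Sum>(x, y, z)\<in>apart3 F. \<psi> x y z)"
      by (rule sum.reindex_bij_witness[of _ "\<lambda>(x, y, z). ((x, y), z)" "\<lambda>((x, y), z). (x, y, z)"])
        (auto simp: apart3_def apart_def)
    finally show ?thesis .
  qed
  have rot1: "(\<Sum>(x, y, z)\<in>apart3 F. 1 / ?s z) = (\<Sum>(x, y, z)\<in>apart3 F. 1 / ?s x)"
    by (rule sum.reindex_bij_witness[of _ "\<lambda>(x, y, z). (z, y, x)" "\<lambda>(x, y, z). (z, y, x)"])
      (auto simp: apart3_def apart_sym)
  have rot2: "(\<Sum>(x, y, z)\<in>apart3 F. 1 / ?s z) = (\<Sum>(x, y, z)\<in>apart3 F. 1 / ?s y)"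
    by (rule sum.reindex_bij_witness[of _ "\<lambda>(x, y, z). (x, z, y)" "\<lambda>(x, y, z). (x, z, y)"])
      (auto simp: apart3_def apart_sym)
  have "real (card V) * (\<Sum>(x, y)\<in>apart F. ncomp V F / real (card V) - 2 / (?s x + ?s y)) =
     (\<Sum>(x, y)\<in>apart F. \<Sum>z\<in>V - reach F x - reach F y. 1 / ?s z - 2 / (?s x + ?s y))"
    unfolding sum_distrib_left using one by (intro sum.cong) auto
  also have "\<dots> = (\<Sum>(x, y, z)\<in>apart3 F. 1 / ?s z) - (\<Sum>(x, y, z)\<in>apart3 F. 2 / (?s x + ?s y))"
    unfolding A3 by (simp add: split_beta sum_subtractf)
  also have "\<dots> = (\<Sum>(x, y, z)\<in>apart3 F. (1 / ?s x + 1 / ?s y) / 2 - 2 / (?s x + ?s y))"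
    using rot1 rot2 by (simp add: split_beta sum_subtractf sum.distrib flip: sum_divide_distrib)
  also have "\<dots> = (\<Sum>(x, y, z)\<in>apart3 F. (?s x - ?s y)\<^sup>2 / (2 * ?s x * ?s y * (?s x + ?s y)))"
  proof (intro sum.cong refl, clarify)
    fix x y z assume "(x, y, z) \<in> apart3 F"
    then have "?s x > 0" "?s y > 0" by (auto simp: apart3_def apart_def intro: pos)
    then show "(1 / ?s x + 1 / ?s y) / 2 - 2 / (?s x + ?s y) = (?s x - ?s y)\<^sup>2 / (2 * ?s x * ?s y * (?s x + ?s y))"
      by (simp add: divide_simps) (simp add: power2_eq_square algebra_simps)
  qed
  finally show ?thesis .
qed

text \<open>The drift is a positive multiple of a sum of squares over triples. Strictness asks for a
  third vertex \<open>z\<close> besides two unequal sizes: with only two components there are no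
  triples and the drift is zero.\<close>

lemma drift_nonneg:
  assumes fd: "forest_degrees V F"
  shows "(\<Sum>(x, y)\<in>apart F. potential V (insert {x, y} F) - potential V F) \<ge> 0"
    and "(x, y, z) \<in> apart3 F \<Longrightarrow> csize F x \<noteq> csize F y \<Longrightarrow>
      (\<Sum>(x, y)\<in>apart F. potential V (insert {x, y} F) - potential V F) > 0"
proof -
  have F: "F \<subseteq> edges_on V" using fd by (simp add: forest_degrees_def)
  let ?t = "\<lambda>(x, y, z). (csize F x - csize F y)\<^sup>2 / (2 * csize F x * csize F y * (csize F x + csize F y))"
  have pos: "csize F x > 0" "csize F y > 0" if "(x, y, z) \<in> apart3 F" for x y z
    using that by (auto simp: apart3_def apart_def intro: csize_pos[OF F])
  have t: "?t p \<ge> 0" if "p \<in> apart3 F" for p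
  proof (cases p)
    case (fields x y z)
    with pos[of x y z] that show ?thesis by (simp add: less_imp_le)
  qed
  have nn: "(\<Sum>p\<in>apart3 F. ?t p) \<ge> 0" by (intro sum_nonneg t)
  \<comment> \<open>The identity with triples carries a factor \<open>card V\<close>, so it says
    nothing for an empty vertex set.\<close>
  have emp: "apart F = {}" if "card V = 0"
    using that finV unfolding apart_def by simp
  show "(\<Sum>(x, y)\<in>apart F. potential V (insert {x, y} F) - potential V F) \<ge> 0"
  proof (cases "card V = 0")
    case False
    then show ?thesis
      using nn unfolding sum_potential_insert[OF fd] sum_apart3[OF F, symmetric]
      by (simp add: zero_le_mult_iff)
  qed (simp add: emp)
  assume xyz: "(x, y, z) \<in> apart3 F" "csize F x \<noteq> csize F y"
  have "?t (x, y, z) > 0" using pos[OF xyz(1)] xyz(2) by simp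
  then have "(\<Sum>p\<in>apart3 F. ?t p) > 0"
    using xyz(1) t finite_apart3 by (intro sum_pos2[of _ "(x, y, z)"]) auto
  moreover have "real (card V) > 0" using xyz(1) finV by (auto simp: apart3_def apart_def card_gt_0_iff)
  ultimately show "(\<Sum>(x, y)\<in>apart F. potential V (insert {x, y} F) - potential V F) > 0"
    unfolding sum_potential_insert[OF fd] sum_apart3[OF F, symmetric]
    by (simp add: zero_less_mult_iff)
qed

end

section \<open>Averaging the potential over all orders of the edges\<close>

lemma spanned_mono: "F \<subseteq> G \<Longrightarrow> spanned F g \<Longrightarrow> spanned G g"
  using reach_mono[of F G] unfolding spanned_def by (meson order_trans)

lemma spanned_kruskal_step: "g \<in> edges_on V \<Longrightarrow> spanned (kruskal_step F g) g"
  by (elim edges_onE) (auto simp: kruskal_step_def intro: reach_edge)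

text \<open>The invariant for the set \<open>R\<close> of edges still to be read: every edge outside
  \<open>R\<close> is spanned. All edges that can still join components are thus in
  \<open>R\<close>, and a uniform choice from \<open>R\<close> treats them equally.\<close>

lemma spanned_after_step:
  assumes "R \<subseteq> edges_on V" "\<And>h. h \<in> edges_on V - R \<Longrightarrow> spanned F h" "g \<in> R"
    and "h \<in> edges_on V - (R - {g})"
  shows "spanned (kruskal_step F g) h"
proof (cases "h = g")
  case True
  then show ?thesis using assms spanned_kruskal_step[of g V F] by auto
next
  case False
  then have "spanned F h" using assms by auto
  then show ?thesis by (rule spanned_mono[rotated]) (auto simp: kruskal_step_def)
qed

text \<open>Conditioning on the first edge. Expectations over a uniform order are written as sums
  over permutations, so the submartingale argument becomes an induction on finite sums.\<close>

lemma sum_permutations_of_set: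
  fixes \<phi> :: "'a list \<Rightarrow> 'b::comm_monoid_add"
  assumes "finite R" "R \<noteq> {}"
  shows "(\<Sum>xs\<in>permutations_of_set R. \<phi> xs) = (\<Sum>g\<in>R. \<Sum>xs\<in>permutations_of_set (R - {g}). \<phi> (g # xs))"
proof -
  have "(\<Sum>xs\<in>permutations_of_set R. \<phi> xs) = (\<Sum>g\<in>R. \<Sum>xs\<in>(#) g ` permutations_of_set (R - {g}). \<phi> xs)"
    unfolding permutations_of_set_nonempty[OF assms(2)] using assms by (intro sum.UNION_disjoint) auto
  then show ?thesis by (simp add: sum.reindex)
qed

context
  fixes V :: "'a set"
  assumes finV: "finite V"
begin

lemma sum_apart_edges:
  fixes \<phi> :: "'a set \<Rightarrow> real"
  shows "(\<Sum>(x, y)\<in>apart V F. \<phi> {x, y}) = 2 * (\<Sum>g\<in>{g \<in> edges_on V. \<not> spanned F g}. \<phi> g)"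
proof -
  let ?f = "\<lambda>p::'a \<times> 'a. {fst p, snd p}"
  let ?X = "{g \<in> edges_on V. \<not> spanned F g}"
  have "(\<Sum>(x, y)\<in>apart V F. \<phi> {x, y}) = (\<Sum>p\<in>apart V F. \<phi> (?f p))" by (simp add: split_beta)
  also have "\<dots> = (\<Sum>g\<in>?X. \<Sum>p\<in>{p \<in> apart V F. ?f p = g}. \<phi> (?f p))"
    using finite_apart[OF finV] finite_edges_on[OF finV]
    by (intro sum.group[symmetric]) (auto simp: apart_def[OF finV])
  also have "\<dots> = (\<Sum>g\<in>?X. 2 * \<phi> g)"
  proof (rule sum.cong[OF refl])
    fix g assume g: "g \<in> ?X"
    then obtain x y where xy: "g = {x, y}" "x \<in> V" "y \<in> V" "x \<noteq> y" by (auto elim: edges_onE)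
    have "{p \<in> apart V F. ?f p = g} = {(x, y), (y, x)}"
      using g xy by (auto simp: apart_def[OF finV] doubleton_eq_iff intro: reach_sym)
    then show "(\<Sum>p\<in>{p \<in> apart V F. ?f p = g}. \<phi> (?f p)) = 2 * \<phi> g"
      using xy by (simp add: insert_commute)
  qed
  finally show ?thesis by (simp add: sum_distrib_left)
qed

lemma forest_degrees_kruskal_step:
  assumes "forest_degrees V F" "g \<in> edges_on V"
  shows "forest_degrees V (kruskal_step F g)"
  using assms(2)
proof (rule edges_onE)
  fix x y assume "g = {x, y}" "x \<in> V" "y \<in> V"
  then show ?thesis using assms(1) forest_degrees_insert[OF finV assms(1), of x y]
    by (auto simp: kruskal_step_def)
qed

lemma forest_degrees_kruskal:
  "forest_degrees V F \<Longrightarrow> set gs \<subseteq> edges_on V \<Longrightarrow> forest_degrees V (kruskal F gs)"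
  by (induction gs arbitrary: F) (auto intro: forest_degrees_kruskal_step)

text \<open>A spanned edge leaves the forest and its potential alone. The division by 2 undoes the
  two orientations under which \<open>apart\<close> lists each joining edge.\<close>

lemma sum_potential_kruskal_step:
  assumes R: "R \<subseteq> edges_on V" "\<And>g. g \<in> edges_on V - R \<Longrightarrow> spanned F g"
  shows "(\<Sum>g\<in>R. potential V (kruskal_step F g)) = real (card R) * potential V F +
     (\<Sum>(x, y)\<in>apart V F. potential V (insert {x, y} F) - potential V F) / 2"
proof -
  have finR: "finite R" using R finite_edges_on[OF finV] finite_subset by blast
  have X: "{g \<in> R. \<not> spanned F g} = {g \<in> edges_on V. \<not> spanned F g}" using R by auto
  have "(\<Sum>g\<in>R. potential V (kruskal_step F g)) = (\<Sum>g\<in>R. potential V F +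
      (if \<not> spanned F g then potential V (insert g F) - potential V F else 0))"
    by (intro sum.cong) (auto simp: kruskal_step_def)
  also have "\<dots> = real (card R) * potential V F + (\<Sum>g\<in>{g \<in> R. \<not> spanned F g}. potential V (insert g F) - potential V F)"
    using finR by (simp add: sum.distrib sum.inter_filter)
  finally show ?thesis
    using sum_apart_edges[where F = F and \<phi> = "\<lambda>g. potential V (insert g F) - potential V F"] by (simp add: X)
qed

text \<open>The submartingale bound, multiplied by the number of orders. The factors
  \<open>fact k\<close> for the later edges and \<open>Suc k\<close> for the first one combine to
  \<open>fact (card R)\<close>.\<close>

lemma sum_potential_kruskal:
  assumes "forest_degrees V F" "R \<subseteq> edges_on V" "\<And>g. g \<in> edges_on V - R \<Longrightarrow> spanned F g"
  shows "fact (card R) * potential V F \<le> (\<Sum>gs\<in>permutations_of_set R. potential V (kruskal F gs))"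
  using assms
proof (induction "card R" arbitrary: F R)
  case 0
  moreover have "finite R" using 0 finite_edges_on[OF finV] finite_subset by blast
  ultimately show ?case by simp
next
  case (Suc k)
  have finR: "finite R" using Suc.prems finite_edges_on[OF finV] finite_subset by blast
  with Suc.hyps have ne: "R \<noteq> {}" by auto
  have "fact k * potential V (kruskal_step F g) \<le> (\<Sum>gs\<in>permutations_of_set (R - {g}). potential V (kruskal F (g # gs)))"
    if g: "g \<in> R" for g
  proof -
    have k: "k = card (R - {g})" using Suc.hyps(2) g by simp
    have gE: "g \<in> edges_on V" using g Suc.prems by auto
    show ?thesis
      using Suc.hyps(1)[OF k forest_degrees_kruskal_step[OF Suc.prems(1) gE] _ spanned_after_step[OF Suc.prems(2,3) g]]
        Suc.prems(2) unfolding k by auto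
  qed
  then have "(\<Sum>g\<in>R. fact k * potential V (kruskal_step F g)) \<le> (\<Sum>gs\<in>permutations_of_set R. potential V (kruskal F gs))"
    unfolding sum_permutations_of_set[OF finR ne] by (intro sum_mono)
  moreover have "real (Suc k) * potential V F \<le> (\<Sum>g\<in>R. potential V (kruskal_step F g))"
    using sum_potential_kruskal_step[OF Suc.prems(2,3)] drift_nonneg(1)[OF finV Suc.prems(1)] Suc.hyps(2) by simp
  then have "fact k * (real (Suc k) * potential V F) \<le> fact k * (\<Sum>g\<in>R. potential V (kruskal_step F g))"
    by (intro mult_left_mono) auto
  ultimately show ?case
    by (simp add: sum_distrib_left Suc.hyps(2)[symmetric] mult_ac)
qed

text \<open>The strict gain comes from the first edge; the remaining edges are handled by the weak
  bound.\<close>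

lemma sum_potential_kruskal_strict:
  assumes fd: "forest_degrees V F" and R: "R \<subseteq> edges_on V" "\<And>g. g \<in> edges_on V - R \<Longrightarrow> spanned F g"
    and xyz: "(x, y, z) \<in> apart3 V F" "csize F x \<noteq> csize F y"
  shows "fact (card R) * potential V F < (\<Sum>gs\<in>permutations_of_set R. potential V (kruskal F gs))"
proof -
  have finR: "finite R" using R finite_edges_on[OF finV] finite_subset by blast
  have "{x, y} \<in> edges_on V" "\<not> spanned F {x, y}"
    using xyz(1) by (auto simp: apart3_def[OF finV] apart_def[OF finV])
  then have ne: "R \<noteq> {}" using R(2)[of "{x, y}"] by auto
  then obtain k where k: "card R = Suc k" using finR by (cases "card R") auto
  have "fact k * potential V (kruskal_step F g) \<le> (\<Sum>gs\<in>permutations_of_set (R - {g}). potential V (kruskal F (g # gs)))"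
    if g: "g \<in> R" for g
  proof -
    have k: "k = card (R - {g})" using k g by simp
    have gE: "g \<in> edges_on V" using g R by auto
    show ?thesis
      using sum_potential_kruskal[OF forest_degrees_kruskal_step[OF fd gE], of "R - {g}"] spanned_after_step[OF R g]
        R(1) unfolding k by auto
  qed
  then have "(\<Sum>g\<in>R. fact k * potential V (kruskal_step F g)) \<le> (\<Sum>gs\<in>permutations_of_set R. potential V (kruskal F gs))"
    unfolding sum_permutations_of_set[OF finR ne] by (intro sum_mono)
  moreover have "real (Suc k) * potential V F < (\<Sum>g\<in>R. potential V (kruskal_step F g))"
    using sum_potential_kruskal_step[OF R] drift_nonneg(2)[OF finV fd xyz] k by simp
  then have "fact k * (real (Suc k) * potential V F) < fact k * (\<Sum>g\<in>R. potential V (kruskal_step F g))"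
    by (intro mult_strict_left_mono) auto
  ultimately show ?thesis
    by (simp add: sum_distrib_left k mult_ac)
qed

text \<open>At the empty forest all sizes are 1 and the drift is zero, so the first edge is split
  off with the weak bound and the strict one is applied to every forest \<open>{g}\<close>.\<close>

lemma sum_potential_kruskal_empty:
  assumes n: "4 \<le> card V"
  shows "fact (card (edges_on V)) * potential V {} < (\<Sum>gs\<in>permutations_of_set (edges_on V). potential V (kruskal {} gs))"
proof -
  let ?E = "edges_on V"
  have finE: "finite ?E" using finV by auto
  have two: "\<exists>z\<in>V. z \<notin> S" if "finite S" "card S \<le> 3" for S
    using card_mono[OF that(1), of V] that(2) n by fastforce
  obtain x0 where "x0 \<in> V" using two[of "{}"] by auto
  moreover obtain y0 where "y0 \<in> V" "y0 \<noteq> x0" using two[of "{x0}"] by auto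
  ultimately have ne: "?E \<noteq> {}" using pair_in_edges_on[of x0 y0 V] by blast
  then obtain k where k: "card ?E = Suc k" using finE by (cases "card ?E") auto
  have "fact k * potential V {g} < (\<Sum>gs\<in>permutations_of_set (?E - {g}). potential V (kruskal {} (g # gs)))"
    if g: "g \<in> ?E" for g
  proof -
    obtain x y where xy: "g = {x, y}" "x \<in> V" "y \<in> V" "x \<noteq> y" using g by (auto elim: edges_onE)
    obtain z where z: "z \<in> V" "z \<notin> {x, y}" using two[of "{x, y}"] xy by auto
    obtain u where u: "u \<in> V" "u \<notin> {x, y, z}" using two[of "{x, y, z}"] xy z by auto
    have fd: "forest_degrees V {g}"
      using forest_degrees_insert[OF finV forest_degrees_empty[OF finV], of x y] xy by simp
    \<comment> \<open>\<open>x\<close> lies in the component of size 2, while \<open>z\<close> and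
      \<open>u\<close> are two isolated vertices, available because there are at least 4
      vertices.\<close>
    have "(x, z, u) \<in> apart3 V {g}" "csize {g} x \<noteq> csize {g} z"
      using xy z u by (auto simp: apart3_def[OF finV] apart_def[OF finV] csize_def reach_insert)
    moreover have "spanned {g} h" if "h \<in> ?E - (?E - {g})" for h
      using that g by (auto intro!: spanned_mem)
    ultimately have "fact (card (?E - {g})) * potential V {g} < (\<Sum>gs\<in>permutations_of_set (?E - {g}). potential V (kruskal {g} gs))"
      by (intro sum_potential_kruskal_strict[OF fd, of _ x z u]) auto
    moreover have "kruskal_step {} g = {g}" using xy by (simp add: kruskal_step_def)
    moreover have "card (?E - {g}) = k" using g k by simp
    ultimately show ?thesis by simp
  qed
  then have "(\<Sum>g\<in>?E. fact k * potential V {g}) < (\<Sum>gs\<in>permutations_of_set ?E. potential V (kruskal {} gs))"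
    unfolding sum_permutations_of_set[OF finE ne] using finE ne by (intro sum_strict_mono)
  moreover have "(\<Sum>g\<in>?E. potential V {g}) = (\<Sum>g\<in>?E. potential V (kruskal_step {} g))"
    by (intro sum.cong refl) (auto simp: kruskal_step_def elim!: edges_onE)
  then have "real (Suc k) * potential V {} \<le> (\<Sum>g\<in>?E. potential V {g})"
    using sum_potential_kruskal_step[of ?E "{}"] drift_nonneg(1)[OF finV forest_degrees_empty[OF finV]] k by simp
  then have "fact k * (real (Suc k) * potential V {}) \<le> fact k * (\<Sum>g\<in>?E. potential V {g})"
    by (intro mult_left_mono) auto
  ultimately show ?thesis by (simp add: sum_distrib_left k mult_ac)
qed

section \<open>The potential at both ends of the process, and disjoint edge pairs in a tree\<close>

lemma potential_empty:
  assumes "V \<noteq> {}"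
  shows "potential V {} = 5 * real (card V) - 11 + 6 / real (card V)"
proof -
  have "real (card V) > 0" using assms finV by (simp add: card_gt_0_iff)
  then show ?thesis
    by (simp add: potential_def ncomp_def csize_def degree_def divide_simps) (simp add: algebra_simps)
qed

text \<open>With a single component the three corrections are 0, -4/n and +4/n.\<close>

lemma potential_connected:
  assumes "V \<noteq> {}" "\<And>v. v \<in> V \<Longrightarrow> reach F v = V"
  shows "potential V F = (\<Sum>v\<in>V. (degree F v)\<^sup>2)"
proof -
  have "real (card V) > 0" using assms(1) finV by (simp add: card_gt_0_iff)
  then show ?thesis
    using assms(2) by (simp add: potential_def ncomp_def csize_def power2_eq_square divide_simps)
qed

lemma degree_incident:
  assumes "F \<subseteq> edges_on V"
  shows "degree F v = real (card {g \<in> F. v \<in> g})"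
proof -
  have "bij_betw (\<lambda>u. {v, u}) {u. {v, u} \<in> F} {g \<in> F. v \<in> g}"
  proof (rule bij_betwI')
    fix g assume "g \<in> {g \<in> F. v \<in> g}"
    then obtain x y where "g = {x, y}" "g \<in> F" "v \<in> g" using assms by (blast elim: edges_onE)
    then show "\<exists>u\<in>{u. {v, u} \<in> F}. g = {v, u}" by (auto simp: insert_commute)
  qed (auto simp: doubleton_eq_iff)
  then show ?thesis by (simp add: degree_def bij_betw_same_card)
qed

text \<open>A weighted handshake lemma: \<psi> = 1 counts the edges of a tree, and \<psi> =
  \<open>degree T\<close> produces the sum of the squared degrees.\<close>

lemma sum_incident:
  assumes F: "F \<subseteq> edges_on V"
  shows "(\<Sum>g\<in>F. \<Sum>v\<in>g. \<psi> v) = (\<Sum>v\<in>V. degree F v * \<psi> v)"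
proof -
  have finF: "finite F" using F finV finite_edges_on finite_subset by blast
  have "(\<Sum>g\<in>F. \<Sum>v\<in>g. \<psi> v) = (\<Sum>g\<in>F. \<Sum>v\<in>{v \<in> V. v \<in> g}. \<psi> v)"
    using F by (intro sum.cong) (auto simp: edges_on_def)
  also have "\<dots> = (\<Sum>v\<in>V. \<Sum>g\<in>{g \<in> F. v \<in> g}. \<psi> v)"
    using finV finF by (intro sum.swap_restrict) auto
  finally show ?thesis by (simp add: degree_incident[OF F])
qed

context
  fixes T :: "'a set set"
  assumes fd: "forest_degrees V T" and conn: "\<And>v. v \<in> V \<Longrightarrow> reach T v = V" and ne: "V \<noteq> {}"
begin

lemma tree_subset: "T \<subseteq> edges_on V" using fd by (simp add: forest_degrees_def)

lemma finite_tree: "finite T" using tree_subset finV finite_edges_on finite_subset by blast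

lemma card_tree: "real (card T) = real (card V) - 1"
proof -
  have "(\<Sum>g\<in>T. \<Sum>v\<in>g. 1::real) = (\<Sum>g\<in>T. 2)"
    using tree_subset by (intro sum.cong) (auto simp: edges_on_def)
  moreover have "(\<Sum>v\<in>V. degree T v) = 2 * (real (card V) - 1)"
    using fd conn ne by (auto simp: forest_degrees_def csize_def)
  ultimately show ?thesis using sum_incident[OF tree_subset, of "\<lambda>_. 1"] by simp
qed

text \<open>Of the n - 1 tree edges, deg x + deg y - 1 meet \<open>g\<close> = {x, y}, since
  \<open>g\<close> itself is counted at both ends. This leaves n - deg x - deg y disjoint ones, to
  be summed over \<open>g\<close>.\<close>

lemma card_disjoint_pairs_tree:
  "real (card {(g, h) \<in> T \<times> T. g \<inter> h = {}}) = real (card V) * (real (card V) - 1) - (\<Sum>v\<in>V. (degree T v)\<^sup>2)"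
proof -
  have "{(g, h) \<in> T \<times> T. g \<inter> h = {}} = (SIGMA g:T. {h \<in> T. g \<inter> h = {}})" by auto
  then have "real (card {(g, h) \<in> T \<times> T. g \<inter> h = {}}) = (\<Sum>g\<in>T. real (card {h \<in> T. g \<inter> h = {}}))"
    using finite_tree by (simp add: card_SigmaI)
  also have "\<dots> = (\<Sum>g\<in>T. real (card V) - (\<Sum>v\<in>g. degree T v))"
  proof (rule sum.cong[OF refl])
    fix g assume g: "g \<in> T"
    then obtain x y where xy: "g = {x, y}" "x \<noteq> y" using tree_subset by (blast elim: edges_onE)
    let ?X = "{h \<in> T. x \<in> h}" and ?Y = "{h \<in> T. y \<in> h}"
    have "h = g" if "h \<in> T" "x \<in> h" "y \<in> h" for h
    proof -
      from that(1) tree_subset have "h \<in> edges_on V" by auto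
      then show ?thesis using that xy by (elim edges_onE) auto
    qed
    moreover have "g \<in> ?X" "g \<in> ?Y" using g xy(1) by simp_all
    ultimately have int: "?X \<inter> ?Y = {g}" by blast
    have "card ?X + card ?Y = card (?X \<union> ?Y) + 1"
      using card_Un_Int[of ?X ?Y] finite_tree by (simp add: int)
    then have "real (card (?X \<union> ?Y)) = degree T x + degree T y - 1"
      by (simp add: degree_incident[OF tree_subset] flip: of_nat_add)
    moreover have "card {h \<in> T. g \<inter> h = {}} + card (?X \<union> ?Y) = card T"
    proof -
      have "T = {h \<in> T. g \<inter> h = {}} \<union> (?X \<union> ?Y)" using xy by auto
      moreover have "{h \<in> T. g \<inter> h = {}} \<inter> (?X \<union> ?Y) = {}" using xy by auto
      ultimately show ?thesis using finite_tree card_Un_disjoint[of "{h \<in> T. g \<inter> h = {}}" "?X \<union> ?Y"] by simp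
    qed
    then have "real (card {h \<in> T. g \<inter> h = {}}) = real (card T) - real (card (?X \<union> ?Y))" by linarith
    ultimately show "real (card {h \<in> T. g \<inter> h = {}}) = real (card V) - (\<Sum>v\<in>g. degree T v)"
      using xy by (simp add: card_tree)
  qed
  also have "\<dots> = real (card V) * (real (card V) - 1) - (\<Sum>v\<in>V. degree T v * degree T v)"
    by (simp add: sum_subtractf card_tree sum_incident[OF tree_subset])
  finally show ?thesis by (simp add: power2_eq_square)
qed

end

lemma kruskal_tree:
  assumes "gs \<in> permutations_of_set (edges_on V)"
  shows "forest_degrees V (kruskal {} gs)" "v \<in> V \<Longrightarrow> reach (kruskal {} gs) v = V"
proof -
  have gs: "set gs = edges_on V" using assms by (simp add: permutations_of_set_def)
  then show "forest_degrees V (kruskal {} gs)"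
    by (intro forest_degrees_kruskal forest_degrees_empty finV) simp
  show "reach (kruskal {} gs) v = V" if "v \<in> V"
    using gs reach_edges_on[OF that] by (simp add: reach_kruskal[of gs V])
qed

end

section \<open>Vertex symmetry\<close>

lemma reach_image:
  assumes "inj \<pi>"
  shows "reach ((`) \<pi> ` F) (\<pi> u) = \<pi> ` reach F u"
proof
  show "reach ((`) \<pi> ` F) (\<pi> u) \<subseteq> \<pi> ` reach F u"
  proof (rule reach_least)
    fix a b assume "a \<in> \<pi> ` reach F u" and "{a, b} \<in> (`) \<pi> ` F"
    then obtain a' g where a': "a = \<pi> a'" "a' \<in> reach F u" and g: "g \<in> F" "{a, b} = \<pi> ` g" by blast
    from g(2) have "b \<in> \<pi> ` g" by blast
    then obtain b' where b': "b = \<pi> b'" by blast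
    from g(2) have "\<pi> ` {a', b'} = \<pi> ` g" by (simp add: a'(1) b')
    then have "{a', b'} = g" by (simp only: inj_image_eq_iff[OF assms])
    then have "b' \<in> reach F a'" using g(1) by (intro reach_edge) simp
    then show "b \<in> \<pi> ` reach F u" using b' reach_trans[OF a'(2)] by blast
  qed auto
  have "reach F u \<subseteq> {v. \<pi> v \<in> reach ((`) \<pi> ` F) (\<pi> u)}"
  proof (rule reach_least)
    fix x y assume x: "x \<in> {v. \<pi> v \<in> reach ((`) \<pi> ` F) (\<pi> u)}" and "{x, y} \<in> F"
    then have "\<pi> ` {x, y} \<in> (`) \<pi> ` F" by (intro imageI)
    then have "\<pi> y \<in> reach ((`) \<pi> ` F) (\<pi> x)" by (intro reach_edge) simp
    moreover have "\<pi> x \<in> reach ((`) \<pi> ` F) (\<pi> u)" using x by simp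
    ultimately have "\<pi> y \<in> reach ((`) \<pi> ` F) (\<pi> u)" by (rule reach_trans[rotated])
    then show "y \<in> {v. \<pi> v \<in> reach ((`) \<pi> ` F) (\<pi> u)}" by simp
  qed auto
  then show "\<pi> ` reach F u \<subseteq> reach ((`) \<pi> ` F) (\<pi> u)" by auto
qed

lemma kruskal_image:
  assumes "inj \<pi>"
  shows "kruskal ((`) \<pi> ` F) (map ((`) \<pi>) gs) = (`) \<pi> ` kruskal F gs"
proof (induction gs rule: rev_induct)
  case (snoc g gs)
  have "spanned ((`) \<pi> ` F) (\<pi> ` g) = spanned F g" for F
    using assms by (auto simp: spanned_def reach_image inj_image_subset_iff)
  then show ?case using snoc by (simp add: kruskal_step_def)
qed auto

text \<open>Bijections between \<open>A\<close> and \<open>A'\<close>, \<open>B\<close> and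
  \<open>B'\<close>, and the two complements are glued together. Two sets are moved at once so that
  a disjoint pair of edges can be sent to any other; a single edge is the case of empty
  \<open>B\<close> and \<open>B'\<close>.\<close>

lemma permutation_moving_sets:
  assumes fin: "finite V" and sub: "A \<subseteq> V" "A' \<subseteq> V" "B \<subseteq> V" "B' \<subseteq> V"
    and dis: "A \<inter> B = {}" "A' \<inter> B' = {}" and card: "card A = card A'" "card B = card B'"
  obtains \<pi> where "\<pi> permutes V" "\<pi> ` A = A'" "\<pi> ` B = B'"
proof -
  have f: "finite A" "finite A'" "finite B" "finite B'" using sub by (auto intro: finite_subset[OF _ fin])
  obtain p where p: "bij_betw p A A'" using finite_same_card_bij[OF f(1,2) card(1)] by blast
  obtain q where q: "bij_betw q B B'" using finite_same_card_bij[OF f(3,4) card(2)] by blast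
  have "card (A \<union> B) = card (A' \<union> B')" using f dis card by (simp add: card_Un_disjoint)
  then have "card (V - (A \<union> B)) = card (V - (A' \<union> B'))" using f sub fin by (simp add: card_Diff_subset)
  then obtain r where r: "bij_betw r (V - (A \<union> B)) (V - (A' \<union> B'))"
    using finite_same_card_bij[OF finite_Diff[OF fin] finite_Diff[OF fin]] by blast
  define \<pi> where "\<pi> = (\<lambda>x. if x \<in> A then p x else if x \<in> B then q x else if x \<in> V then r x else x)"
  have 1: "bij_betw \<pi> A A'" using p by (rule bij_betw_cong[THEN iffD1, rotated]) (auto simp: \<pi>_def)
  have 2: "bij_betw \<pi> B B'" using q by (rule bij_betw_cong[THEN iffD1, rotated]) (use dis in \<open>auto simp: \<pi>_def\<close>)
  have 3: "bij_betw \<pi> (V - (A \<union> B)) (V - (A' \<union> B'))"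
    using r by (rule bij_betw_cong[THEN iffD1, rotated]) (auto simp: \<pi>_def)
  have "bij_betw \<pi> (A \<union> B \<union> (V - (A \<union> B))) (A' \<union> B' \<union> (V - (A' \<union> B')))"
    using bij_betw_combine[OF bij_betw_combine[OF 1 2 dis(2)] 3] by auto
  moreover have "A \<union> B \<union> (V - (A \<union> B)) = V" "A' \<union> B' \<union> (V - (A' \<union> B')) = V" using sub by auto
  ultimately have "bij_betw \<pi> V V" by simp
  moreover have "\<pi> x = x" if "x \<notin> V" for x using that sub by (auto simp: \<pi>_def)
  ultimately have "\<pi> permutes V" by (rule bij_imp_permutes)
  then show thesis using that 1 2 by (simp add: bij_betw_def)
qed

text \<open>Relabelling the vertices permutes the edge orders and commutes with Kruskal's algorithm,
  so it matches the two sets of orders bijectively. Taking \<open>e\<close> = \<open>f\<close> gives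
  the count for one edge.\<close>

lemma kruskal_count_permute:
  assumes \<pi>: "\<pi> permutes V"
  shows "card {gs \<in> permutations_of_set (edges_on V). \<pi> ` e \<in> kruskal {} gs \<and> \<pi> ` f \<in> kruskal {} gs} =
         card {gs \<in> permutations_of_set (edges_on V). e \<in> kruskal {} gs \<and> f \<in> kruskal {} gs}"
proof -
  let ?P = "permutations_of_set (edges_on V)" and ?m = "map ((`) \<pi>)"
  have inj: "inj \<pi>" using \<pi> by (rule permutes_inj)
  have inj': "inj ((`) \<pi>)" by (rule injI) (simp only: inj_image_eq_iff[OF inj])
  have "(`) \<pi> ` edges_on V = edges_on V"
  proof
    show "(`) \<pi> ` edges_on V \<subseteq> edges_on V"
      using permutes_in_image[OF \<pi>] by (auto simp: edges_on_def card_image inj_on_subset[OF inj])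
    show "edges_on V \<subseteq> (`) \<pi> ` edges_on V"
    proof
      fix g assume "g \<in> edges_on V"
      moreover from this have "g = \<pi> ` (inv \<pi> ` g)" using permutes_surj[OF \<pi>] by (simp add: image_f_inv_f)
      moreover have "inv \<pi> permutes V" using \<pi> by (rule permutes_inv)
      ultimately show "g \<in> (`) \<pi> ` edges_on V"
        using permutes_in_image[OF \<open>inv \<pi> permutes V\<close>]
        by (auto simp: edges_on_def card_image inj_on_subset[OF permutes_inj[OF \<open>inv \<pi> permutes V\<close>]] intro!: image_eqI[of _ _ "inv \<pi> ` g"])
    qed
  qed
  then have P: "?m ` ?P = ?P"
    using permutations_of_set_image_inj[OF inj_on_subset[OF inj'], of "edges_on V"] by simp
  have k: "\<pi> ` g \<in> kruskal {} (?m gs) \<longleftrightarrow> g \<in> kruskal {} gs" for g gs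
    using kruskal_image[OF inj, of "{}" gs] inj_image_mem_iff[OF inj', of g "kruskal {} gs"] by simp
  have "{gs \<in> ?P. \<pi> ` e \<in> kruskal {} gs \<and> \<pi> ` f \<in> kruskal {} gs} = ?m ` {gs \<in> ?P. e \<in> kruskal {} gs \<and> f \<in> kruskal {} gs}"
    (is "?L = ?R")
  proof
    show "?L \<subseteq> ?R"
    proof
      fix hs assume hs: "hs \<in> ?L"
      then obtain gs where "gs \<in> ?P" "hs = ?m gs" using P by auto
      then show "hs \<in> ?R" using hs by (auto simp: k)
    qed
    show "?R \<subseteq> ?L" using P by (auto simp: k)
  qed
  then show ?thesis using card_image[OF inj_on_subset[OF inj_mapI[OF inj'] subset_UNIV]] by simp
qed

section \<open>Counting the edge orders that select given edges\<close>

lemma card_edges_on: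
  assumes "finite U"
  shows "real (card (edges_on U)) = real (card U) * (real (card U) - 1) / 2"
proof -
  have "card (edges_on U) = card U * (card U - 1) div 2"
    using n_subsets[OF assms, of 2] by (simp add: edges_on_def choose_two)
  moreover have "even (card U * (card U - 1))" by (cases "even (card U)") auto
  ultimately have "2 * card (edges_on U) = card U * (card U - 1)" by (simp only: dvd_mult_div_cancel)
  then have "2 * real (card (edges_on U)) = real (card U) * real (card U - 1)"
    by (simp flip: of_nat_mult)
  \<comment> \<open>The case \<open>card U = 0\<close> is separate because the natural number
    \<open>card U - 1\<close> is truncated there.\<close>
  then show ?thesis by (cases "card U") simp_all
qed

lemma kruskal_edge_count:
  assumes fin: "finite V" and e: "e \<in> edges_on V"
  shows "real (card {gs \<in> permutations_of_set (edges_on V). e \<in> kruskal {} gs}) =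
    2 / real (card V) * fact (card (edges_on V))"
proof -
  let ?E = "edges_on V" and ?P = "permutations_of_set (edges_on V)" and ?n = "real (card V)"
  let ?c = "\<lambda>e. card {gs \<in> ?P. e \<in> kruskal {} gs}"
  have finE: "finite ?E" using fin by auto
  have ne: "V \<noteq> {}" using e by (auto elim: edges_onE)
  have n: "2 \<le> card V" using e card_mono[OF fin, of e] by (auto simp: edges_on_def)
  have same: "?c g = ?c e" if g: "g \<in> ?E" for g
  proof -
    obtain \<pi> where "\<pi> permutes V" "\<pi> ` e = g"
      by (rule permutation_moving_sets[OF fin, of e g "{}" "{}"]) (use e g in \<open>auto simp: edges_on_def\<close>)
    then show ?thesis using kruskal_count_permute[of \<pi> V e e] by simp
  qed
  \<comment> \<open>The pairs of an order and an edge selected by it are counted in two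
    ways.\<close>
  have "?n * (?n - 1) / 2 * real (?c e) = (\<Sum>g\<in>?E. real (?c g))"
    using same by (simp add: card_edges_on[OF fin])
  also have "\<dots> = (\<Sum>g\<in>?E. \<Sum>gs\<in>?P. of_bool (g \<in> kruskal {} gs))"
    by (intro sum.cong) (auto simp: Int_def)
  also have "\<dots> = (\<Sum>gs\<in>?P. \<Sum>g\<in>?E. of_bool (g \<in> kruskal {} gs))" by (rule sum.swap)
  also have "\<dots> = (\<Sum>gs\<in>?P. ?n - 1)"
  proof (rule sum.cong[OF refl])
    fix gs assume gs: "gs \<in> ?P"
    note t = kruskal_tree[OF fin gs]
    have "?E \<inter> kruskal {} gs = kruskal {} gs" using tree_subset[OF fin t ne] by auto
    then show "(\<Sum>g\<in>?E. of_bool (g \<in> kruskal {} gs)) = ?n - 1"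
      using card_tree[OF fin t ne] finE by (simp add: Int_def)
  qed
  also have "\<dots> = fact (card ?E) * (?n - 1)" using finE by simp
  finally have "(?n - 1) * (?n * real (?c e) / 2) = (?n - 1) * fact (card ?E)" by (simp add: mult_ac)
  then have "?n * real (?c e) / 2 = fact (card ?E)" using n by (simp only: mult_cancel_left) simp
  then show ?thesis using n by (simp add: field_simps)
qed

lemma kruskal_disjoint_count:
  assumes fin: "finite V" and n: "4 \<le> card V" and e: "e \<in> edges_on V" "f \<in> edges_on V" "e \<inter> f = {}"
  shows "real (card {gs \<in> permutations_of_set (edges_on V). e \<in> kruskal {} gs \<and> f \<in> kruskal {} gs}) <
    4 / (real (card V))\<^sup>2 * fact (card (edges_on V))"
proof -
  let ?E = "edges_on V" and ?P = "permutations_of_set (edges_on V)" and ?n = "real (card V)"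
  let ?c = "\<lambda>e f. card {gs \<in> ?P. e \<in> kruskal {} gs \<and> f \<in> kruskal {} gs}"
  let ?D = "SIGMA g:?E. {h \<in> ?E. g \<inter> h = {}}"
  have finE: "finite ?E" using fin by auto
  have finD: "finite ?D" using finE by auto
  have ne: "V \<noteq> {}" using n by auto
  have same: "?c g h = ?c e f" if gh: "(g, h) \<in> ?D" for g h
  proof -
    obtain \<pi> where "\<pi> permutes V" "\<pi> ` e = g" "\<pi> ` f = h"
      by (rule permutation_moving_sets[OF fin, of e g f h]) (use e gh in \<open>auto simp: edges_on_def\<close>)
    then show ?thesis using kruskal_count_permute[of \<pi> V e f] by simp
  qed
  \<comment> \<open>The edges disjoint from \<open>g\<close> are the edges of the complete graph on
    the other n - 2 vertices.\<close>
  have "card {h \<in> ?E. g \<inter> h = {}} = card (edges_on (V - g))" for g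
    by (rule arg_cong[of _ _ card]) (auto simp: edges_on_def)
  moreover have "real (card (V - g)) = ?n - 2" if "g \<in> ?E" for g
    using that fin n by (auto simp: edges_on_def card_Diff_subset finite_subset of_nat_diff)
  ultimately have "real (card ?D) = (\<Sum>g\<in>?E. (?n - 2) * (?n - 3) / 2)"
    using finE fin by (simp add: card_SigmaI card_edges_on)
  then have D: "real (card ?D) = ?n * (?n - 1) * (?n - 2) * (?n - 3) / 4"
    by (simp add: card_edges_on[OF fin])
  have "real (card ?D) * real (?c e f) = (\<Sum>p\<in>?D. real (?c e f))"
    by simp
  also have "\<dots> = (\<Sum>p\<in>?D. real (?c (fst p) (snd p)))"
  proof (rule sum.cong[OF refl])
    fix p assume p: "p \<in> ?D"
    obtain g h where "p = (g, h)" by (cases p)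
    then show "real (?c e f) = real (?c (fst p) (snd p))" using same[of g h] p by (simp del: mem_Sigma_iff)
  qed
  also have "\<dots> = (\<Sum>p\<in>?D. \<Sum>gs\<in>?P. of_bool (fst p \<in> kruskal {} gs \<and> snd p \<in> kruskal {} gs))"
    by (intro sum.cong) (auto simp: Int_def)
  also have "\<dots> = (\<Sum>gs\<in>?P. \<Sum>p\<in>?D. of_bool (fst p \<in> kruskal {} gs \<and> snd p \<in> kruskal {} gs))" by (rule sum.swap)
  also have "\<dots> = (\<Sum>gs\<in>?P. ?n * (?n - 1) - potential V (kruskal {} gs))"
  proof (rule sum.cong[OF refl])
    fix gs assume gs: "gs \<in> ?P"
    note t = kruskal_tree[OF fin gs]
    let ?T = "kruskal {} gs"
    have "?D \<inter> {p. fst p \<in> ?T \<and> snd p \<in> ?T} = {(g, h) \<in> ?T \<times> ?T. g \<inter> h = {}}"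
      using tree_subset[OF fin t ne] by auto
    then have "(\<Sum>p\<in>?D. of_bool (fst p \<in> ?T \<and> snd p \<in> ?T)) = real (card {(g, h) \<in> ?T \<times> ?T. g \<inter> h = {}})"
      using finD by simp
    then show "(\<Sum>p\<in>?D. of_bool (fst p \<in> ?T \<and> snd p \<in> ?T)) = ?n * (?n - 1) - potential V ?T"
      using card_disjoint_pairs_tree[OF fin t ne] potential_connected[OF fin ne t(2)] by simp
  qed
  also have "\<dots> < fact (card ?E) * (?n * (?n - 1) - potential V {})"
    using sum_potential_kruskal_empty[OF fin n] finE by (simp add: sum_subtractf right_diff_distrib)
  \<comment> \<open>Both sides equal (n-1)(n-2)(n-3)/n: the value at the empty forest corresponds
    exactly to pair probability 4/n^2.\<close>
  also have "?n * (?n - 1) - potential V {} = 4 / ?n\<^sup>2 * real (card ?D)"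
    unfolding D potential_empty[OF fin ne] using n by (simp add: divide_simps) (simp add: algebra_simps power2_eq_square)
  finally have "real (card ?D) * real (?c e f) < real (card ?D) * (4 / ?n\<^sup>2 * fact (card ?E))"
    by (simp add: mult_ac)
  moreover have "real (card ?D) > 0" using n unfolding D by simp
  ultimately show ?thesis by (simp only: mult_less_cancel_left_pos)
qed

section \<open>Minimum spanning trees\<close>

lemma reach_spanned_mono:
  assumes "\<And>h. h \<in> F \<Longrightarrow> spanned G h"
  shows "reach F u \<subseteq> reach G u"
proof (rule reach_least)
  fix x y assume x: "x \<in> reach G u" and "{x, y} \<in> F"
  then have "y \<in> reach G x" using assms[of "{x, y}"] by simp
  with x show "y \<in> reach G u" by (rule reach_trans)
qed auto

lemma spanned_trans:
  assumes "\<And>h. h \<in> F \<Longrightarrow> spanned G h" "spanned F g"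
  shows "spanned G g"
proof -
  have "reach F u \<subseteq> reach G u" for u using assms(1) by (rule reach_spanned_mono)
  then show ?thesis using assms(2) unfolding spanned_def by blast
qed

lemma simple_path:
  assumes "y \<in> reach F x"
  obtains xs where "xs \<noteq> []" "hd xs = x" "last xs = y" "distinct xs" "successively (\<lambda>a b. {a, b} \<in> F) xs"
proof -
  have "(x, y) \<in> {(x, y). {x, y} \<in> F}\<^sup>*" using assms by (simp add: reach_def)
  then have "\<exists>xs. xs \<noteq> [] \<and> hd xs = x \<and> last xs = y \<and> distinct xs \<and> successively (\<lambda>a b. {a, b} \<in> F) xs"
  proof induction
    case base
    show ?case by (rule exI[of _ "[x]"]) simp
  next
    case (step y z)
    then obtain xs where xs: "xs \<noteq> []" "hd xs = x" "last xs = y" "distinct xs" "successively (\<lambda>a b. {a, b} \<in> F) xs"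
      by blast
    show ?case
    proof (cases "z \<in> set xs")
      case True
      \<comment> \<open>A path that has already visited \<open>z\<close> is cut off at that
        visit.\<close>
      then obtain as bs where ab: "xs = as @ z # bs" by (meson split_list)
      have "hd (as @ [z]) = x" using xs(2) ab by (cases as) auto
      moreover have "successively (\<lambda>a b. {a, b} \<in> F) (as @ [z])"
        using xs(5) unfolding ab by (simp add: successively_append_iff)
      ultimately show ?thesis using xs(4) ab by (intro exI[of _ "as @ [z]"]) auto
    next
      case False
      have "successively (\<lambda>a b. {a, b} \<in> F) (xs @ [z])"
        using xs step.hyps(2) by (simp add: successively_append_iff)
      then show ?thesis using xs False by (intro exI[of _ "xs @ [z]"]) simp
    qed
  qed
  then show thesis using that by blast
qed

text \<open>The closing edge of a cycle is spanned by its other edges; conversely, a simple path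
  between the ends of \<open>g\<close> that avoids \<open>g\<close> closes up to a cycle. From here
  on acyclicity is a statement about \<open>spanned\<close>, without vertex lists.\<close>

lemma acyclic_iff_spanned:
  assumes F: "F \<subseteq> edges_on V"
  shows "(\<exists>xs. is_cycle F xs) \<longleftrightarrow> (\<exists>g\<in>F. spanned (F - {g}) g)"
proof
  assume "\<exists>xs. is_cycle F xs"
  then obtain xs where xs: "3 \<le> length xs" "distinct xs"
    and edge: "\<And>i. i < length xs \<Longrightarrow> {xs ! i, xs ! (Suc i mod length xs)} \<in> F"
    by (auto simp: is_cycle_def)
  define m where "m = length xs - 1"
  have len: "length xs = Suc m" and m: "2 \<le> m" using xs(1) by (auto simp: m_def)
  let ?g = "{xs ! 0, xs ! m}"
  have "xs ! i \<in> reach (F - {?g}) (xs ! 0)" if "i \<le> m" for i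
    using that
  proof (induction i)
    case (Suc i)
    have i: "Suc i mod length xs = Suc i" using Suc.prems len by simp
    \<comment> \<open>Equality would force i = 0 and m = 1, but a cycle has m \<ge> 2.\<close>
    have "{xs ! i, xs ! Suc i} \<noteq> ?g"
      using Suc.prems xs(2) len m by (auto simp: doubleton_eq_iff nth_eq_iff_index_eq)
    then have "{xs ! i, xs ! Suc i} \<in> F - {?g}" using edge[of i] Suc.prems len unfolding i by simp
    then have "xs ! Suc i \<in> reach (F - {?g}) (xs ! i)" by (rule reach_edge)
    then show ?case using Suc by (intro reach_trans[OF Suc.IH]) auto
  qed simp
  then have "spanned (F - {?g}) ?g" by simp
  moreover have "?g \<in> F" using edge[of m] len by (simp add: insert_commute)
  ultimately show "\<exists>g\<in>F. spanned (F - {g}) g" by blast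
next
  assume "\<exists>g\<in>F. spanned (F - {g}) g"
  then obtain g where g: "g \<in> F" "spanned (F - {g}) g" by blast
  from g(1) F have "g \<in> edges_on V" by blast
  then obtain x y where xy: "g = {x, y}" "x \<noteq> y" by (elim edges_onE)
  have "y \<in> reach (F - {g}) x" using g(2) xy by simp
  then obtain xs where xs: "xs \<noteq> []" "hd xs = x" "last xs = y" "distinct xs"
    and path: "successively (\<lambda>a b. {a, b} \<in> F - {g}) xs" by (rule simple_path)
  obtain z zs where z: "xs = x # z # zs"
    using xs xy(2) by (cases xs; cases "tl xs") auto
  \<comment> \<open>A path with just two vertices would be the removed edge \<open>g\<close> itself;
    this gives the third vertex that a cycle requires.\<close>
  have "zs \<noteq> []"
  proof
    assume "zs = []"
    then show False using path xs(3) xy by (simp add: z)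
  qed
  then have len: "3 \<le> length xs" using z by (cases zs) auto
  have step: "{xs ! i, xs ! Suc i} \<in> F" if "Suc i < length xs" for i
  proof -
    have "xs = take i xs @ xs ! i # xs ! Suc i # drop (Suc (Suc i)) xs"
      using that by (simp add: Cons_nth_drop_Suc)
    then have "successively (\<lambda>a b. {a, b} \<in> F - {g}) (take i xs @ xs ! i # xs ! Suc i # drop (Suc (Suc i)) xs)"
      using path by simp
    then show ?thesis by (simp add: successively_append_iff)
  qed
  have "{xs ! i, xs ! (Suc i mod length xs)} \<in> F" if "i < length xs" for i
  proof (cases "Suc i < length xs")
    case True
    then show ?thesis using step by simp
  next
    case False
    then have "Suc i = length xs" using that by simp
    then have "i = length xs - 1" "Suc i mod length xs = 0" by auto
    moreover have "xs ! (length xs - 1) = y" "xs ! 0 = x"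
      using xs by (simp_all add: last_conv_nth hd_conv_nth)
    ultimately show ?thesis using g(1) xy by (simp add: insert_commute)
  qed
  then show "\<exists>xs. is_cycle F xs" using len xs(4) unfolding is_cycle_def by blast
qed

lemma is_spanning_tree_iff:
  "is_spanning_tree V (edges_on V) T \<longleftrightarrow>
     T \<subseteq> edges_on V \<and> (\<forall>u\<in>V. V \<subseteq> reach T u) \<and> (\<forall>g\<in>T. \<not> spanned (T - {g}) g)"
proof (cases "T \<subseteq> edges_on V")
  case True
  show ?thesis
    unfolding is_spanning_tree_def connected_graph_reach acyclic_iff_spanned[OF True] by blast
qed (simp add: is_spanning_tree_def)

text \<open>A connection between \<open>c\<close> and \<open>d\<close> that only \<open>h\<close>
  makes possible passes through \<open>h\<close>; the ends of \<open>h\<close> are named in the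
  direction of the passage.\<close>

lemma spanned_insertE:
  assumes "spanned (insert h S) k" "\<not> spanned S k" "k = {c, d}" "h \<in> edges_on V"
  obtains a b where "h = {a, b}" "c \<in> reach S a" "d \<in> reach S b"
proof -
  obtain x y where h: "h = {x, y}" using assms(4) by (elim edges_onE)
  have "(x \<in> reach S c \<and> d \<in> reach S y) \<or> (y \<in> reach S c \<and> d \<in> reach S x)"
    using assms(1,2) unfolding h assms(3) by (auto simp: reach_insert split: if_splits)
  then show thesis
  proof
    assume "x \<in> reach S c \<and> d \<in> reach S y"
    then show thesis using that[of x y] h reach_sym[of x S c] by simp
  next
    assume "y \<in> reach S c \<and> d \<in> reach S x"
    then show thesis using that[of y x] h reach_sym[of y S c] by (simp add: insert_commute)
  qed
qed

text \<open>\<open>h\<close> crosses the cut left by removing \<open>g\<close>, so the ends of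
  \<open>g\<close> are connected again through \<open>h\<close>. If \<open>h\<close> closed a cycle
  through a kept edge \<open>k\<close>, the rest of that cycle would connect the ends of
  \<open>h\<close> inside \<open>T - {g}\<close>.\<close>

lemma spanning_tree_exchange:
  assumes T: "is_spanning_tree V (edges_on V) T" and g: "g \<in> T"
    and h: "h \<in> edges_on V" "\<not> spanned (T - {g}) h"
  shows "is_spanning_tree V (edges_on V) (insert h (T - {g}))"
proof -
  let ?S = "T - {g}"
  have TE: "T \<subseteq> edges_on V" and conn: "\<And>u. u \<in> V \<Longrightarrow> V \<subseteq> reach T u"
    and acyc: "\<And>k. k \<in> T \<Longrightarrow> \<not> spanned (T - {k}) k"
    using T by (auto simp: is_spanning_tree_iff)
  obtain a b where ab: "h = {a, b}" "a \<in> V" "b \<in> V" using h(1) by (elim edges_onE)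
  have gE: "g \<in> edges_on V" using g TE by blast
  have "insert g ?S = T" using g by auto
  moreover have "spanned T h" using ab conn by auto
  ultimately have "spanned (insert g ?S) h" by simp
  then obtain x y where xy: "g = {x, y}" "a \<in> reach ?S x" "b \<in> reach ?S y"
    using spanned_insertE[OF _ h(2) ab(1) gE] by blast
  have sub: "reach ?S u \<subseteq> reach (insert h ?S) u" for u by (rule reach_mono) auto
  have "b \<in> reach (insert h ?S) a" using ab(1) by (intro reach_edge) simp
  moreover have "a \<in> reach (insert h ?S) x" "b \<in> reach (insert h ?S) y"
    using xy(2,3) sub by blast+
  ultimately have "y \<in> reach (insert h ?S) x" by (meson reach_trans reach_sym)
  then have g_sp: "spanned (insert h ?S) g" using xy(1) by simp
  have "spanned (insert h ?S) k" if "k \<in> T" for k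
  proof (cases "k = g")
    case False
    then show ?thesis using that TE by (intro spanned_mem[of _ _ V]) auto
  qed (simp add: g_sp)
  then have "reach T u \<subseteq> reach (insert h ?S) u" for u by (rule reach_spanned_mono)
  then have c: "\<forall>u\<in>V. V \<subseteq> reach (insert h ?S) u" using conn by blast
  have "\<not> spanned (insert h ?S - {k}) k" if k: "k \<in> insert h ?S" for k
  proof (cases "k = h")
    case True
    then show ?thesis using h(2) spanned_mono[of "insert h ?S - {k}" ?S k] by auto
  next
    case False
    with k have kT: "k \<in> T" "k \<in> ?S" by auto
    then have "k \<in> edges_on V" using TE by auto
    then obtain c d where cd: "k = {c, d}" by (elim edges_onE)
    let ?R = "?S - {k}"
    have R: "\<not> spanned ?R k" using acyc[OF kT(1)] spanned_mono[of ?R "T - {k}" k] by auto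
    have eq: "insert h ?S - {k} = insert h ?R" using False by auto
    show ?thesis
    proof
      assume "spanned (insert h ?S - {k}) k"
      then have "spanned (insert h ?R) k" by (simp only: eq)
      then obtain p q where pq: "h = {p, q}" "c \<in> reach ?R p" "d \<in> reach ?R q"
        using spanned_insertE[OF _ R cd h(1)] by blast
      have "reach ?R u \<subseteq> reach ?S u" for u by (rule reach_mono) auto
      then have "c \<in> reach ?S p" "d \<in> reach ?S q" using pq by blast+
      moreover have "d \<in> reach ?S c" using kT(2) unfolding cd by (rule reach_edge)
      ultimately have "q \<in> reach ?S p" by (meson reach_trans reach_sym)
      then show False using h(2) pq(1) by simp
    qed
  qed
  then show ?thesis using c TE h(1) unfolding is_spanning_tree_iff by auto
qed

text \<open>A connecting edge set with fewest edges is a tree, because a spanned edge could be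
  dropped from it.\<close>

lemma ex_spanning_tree:
  assumes fin: "finite V"
  shows "\<exists>T. is_spanning_tree V (edges_on V) T"
proof -
  let ?P = "\<lambda>F. F \<subseteq> edges_on V \<and> (\<forall>u\<in>V. V \<subseteq> reach F u)"
  have "?P (edges_on V)" by (simp add: reach_edges_on)
  then obtain T where T: "?P T" and least: "\<And>F. ?P F \<Longrightarrow> card T \<le> card F"
    using ex_has_least_nat[of ?P "edges_on V" card] by blast
  have finT: "finite T" using T fin finite_edges_on finite_subset by blast
  have "\<not> spanned (T - {g}) g" if g: "g \<in> T" for g
  proof
    assume sp: "spanned (T - {g}) g"
    have "spanned (T - {g}) k" if "k \<in> T" for k
    proof (cases "k = g")
      case False
      then show ?thesis using that T by (intro spanned_mem[of _ _ V]) auto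
    qed (simp add: sp)
    then have "reach T u \<subseteq> reach (T - {g}) u" for u by (rule reach_spanned_mono)
    then have "?P (T - {g})" using T by blast
    from least[OF this] have "card T \<le> card (T - {g})" .
    moreover have "card (T - {g}) < card T" using finT g by (rule card_Diff1_less)
    ultimately show False by simp
  qed
  then show ?thesis using T by (auto simp: is_spanning_tree_iff)
qed

lemma ex_min_spanning_tree:
  assumes fin: "finite V"
  shows "\<exists>T. is_min_spanning_tree V (edges_on V) w T"
proof -
  let ?S = "{T. is_spanning_tree V (edges_on V) T}"
  have "finite ?S"
    by (rule finite_subset[of _ "Pow (edges_on V)"]) (auto simp: is_spanning_tree_def finite_edges_on[OF fin])
  moreover have "?S \<noteq> {}" using ex_spanning_tree[OF fin] by auto
  ultimately have "arg_min_on (sum w) ?S \<in> ?S" "\<not> (\<exists>x\<in>?S. sum w x < sum w (arg_min_on (sum w) ?S))"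
    using arg_min_if_finite[of ?S "sum w"] by blast+
  then show ?thesis unfolding is_min_spanning_tree_def by (metis mem_Collect_eq not_le)
qed

text \<open>The right side depends on the order of the weights only and does not mention
  \<open>T\<close>; this yields uniqueness and agreement with \<open>kruskal_sorted\<close>. Both
  inclusions come from exchanges that would lower the total weight.\<close>

lemma min_spanning_tree_unspanned:
  assumes fin: "finite V" and inj: "inj_on w (edges_on V)"
    and T: "is_min_spanning_tree V (edges_on V) w T"
  shows "T = {g \<in> edges_on V. \<not> spanned {h \<in> edges_on V. w h < w g} g}"
proof -
  let ?E = "edges_on V" and ?L = "\<lambda>g. {h \<in> edges_on V. w h < w g}"
  have tree: "is_spanning_tree V ?E T" and min: "\<And>S. is_spanning_tree V ?E S \<Longrightarrow> sum w T \<le> sum w S"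
    using T by (auto simp: is_min_spanning_tree_def)
  have TE: "T \<subseteq> ?E" and conn: "\<And>u. u \<in> V \<Longrightarrow> V \<subseteq> reach T u"
    and acyc: "\<And>k. k \<in> T \<Longrightarrow> \<not> spanned (T - {k}) k"
    using tree by (auto simp: is_spanning_tree_iff)
  have finT: "finite T" using TE fin finite_edges_on finite_subset by blast
  have no_improvement: "w g \<le> w h" if "g \<in> T" "h \<in> ?E" "\<not> spanned (T - {g}) h" for g h
  proof -
    have "h \<notin> T - {g}" using that spanned_mem[of h "T - {g}" V] by blast
    then have "sum w (insert h (T - {g})) = w h + sum w T - w g"
      using finT that(1) by (simp add: sum_diff1)
    then show ?thesis using min[OF spanning_tree_exchange[OF tree that]] by simp
  qed
  have "\<not> spanned (?L g) g" if g: "g \<in> T" for g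
  proof
    assume "spanned (?L g) g"
    \<comment> \<open>A lighter edge not spanned by \<open>T - {g}\<close> could replace
      \<open>g\<close>. Once all lighter edges are spanned, so is \<open>g\<close> by transitivity,
      against acyclicity.\<close>
    moreover have "spanned (T - {g}) h" if "h \<in> ?L g" for h
      using no_improvement[OF g, of h] that by auto
    ultimately show False using acyc[OF g] spanned_trans[of "?L g" "T - {g}" g] by blast
  qed
  moreover have "g \<in> T" if g: "g \<in> ?E" "\<not> spanned (?L g) g" for g
  proof (rule ccontr)
    assume gT: "g \<notin> T"
    obtain a b where ab: "g = {a, b}" "a \<in> V" "b \<in> V" using g(1) by (elim edges_onE)
    have "spanned T g" using ab conn by auto
    \<comment> \<open>A smallest such \<open>S\<close> plays the role of the tree path joining the
      ends of \<open>g\<close>. It contains an edge \<open>k\<close> heavier than \<open>g\<close>,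
      and by minimality the ends of \<open>g\<close> lie on different sides of \<open>k\<close>, so
      \<open>g\<close> could replace \<open>k\<close>.\<close>
    then obtain S where S: "S \<subseteq> T" "spanned S g" and least: "\<And>R. R \<subseteq> T \<and> spanned R g \<Longrightarrow> card S \<le> card R"
      using ex_has_least_nat[of "\<lambda>S. S \<subseteq> T \<and> spanned S g" T card] by blast
    have "\<not> S \<subseteq> ?L g" using g(2) S(2) spanned_mono by blast
    then obtain k where k: "k \<in> S" "\<not> w k < w g" using S(1) TE by blast
    then have kT: "k \<in> T" "k \<in> ?E" using S TE by auto
    then have less: "w g < w k"
      using k(2) gT g(1) inj_onD[OF inj, of g k] by (cases "w g = w k") auto
    have finS: "finite S" using S(1) finT finite_subset by blast
    have nS: "\<not> spanned (S - {k}) g"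
      using least[of "S - {k}"] S(1) card_Diff1_less[OF finS k(1)] by auto
    have "insert k (S - {k}) = S" using k(1) by auto
    then obtain x y where xy: "k = {x, y}" "a \<in> reach (S - {k}) x" "b \<in> reach (S - {k}) y"
      using spanned_insertE[OF _ nS ab(1) kT(2)] S(2) by auto
    have "\<not> spanned (T - {k}) g"
    proof
      assume "spanned (T - {k}) g"
      then have "b \<in> reach (T - {k}) a" using ab(1) by simp
      moreover have "reach (S - {k}) u \<subseteq> reach (T - {k}) u" for u using S(1) by (intro reach_mono) auto
      then have "a \<in> reach (T - {k}) x" "b \<in> reach (T - {k}) y" using xy by blast+
      ultimately have "y \<in> reach (T - {k}) x" by (meson reach_trans reach_sym)
      then show False using acyc[OF kT(1)] xy(1) by simp
    qed
    then show False using no_improvement[OF kT(1) g(1)] less by simp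
  qed
  ultimately show ?thesis using TE by blast
qed

lemma ex1_min_spanning_tree:
  assumes "finite V" "inj_on w (edges_on V)"
  shows "\<exists>!T. is_min_spanning_tree V (edges_on V) w T"
proof (rule ex_ex1I[OF ex_min_spanning_tree[OF assms(1)]])
  fix T S assume "is_min_spanning_tree V (edges_on V) w T" "is_min_spanning_tree V (edges_on V) w S"
  then show "T = S" using min_spanning_tree_unspanned[OF assms] by blast
qed

lemma min_spanning_tree_kruskal:
  assumes fin: "finite V" and gs: "gs \<in> permutations_of_set (edges_on V)"
    and sorted: "sorted_wrt (\<lambda>a b. w a < w b) gs"
    and T: "is_min_spanning_tree V (edges_on V) w T"
  shows "T = kruskal {} gs"
proof -
  have set: "set gs = edges_on V" using gs by (simp add: permutations_of_set_def)
  have "sorted_wrt (<) (map w gs)" using sorted by (simp add: sorted_wrt_map)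
  then have "distinct (map w gs)" by (simp add: strict_sorted_iff)
  then have "inj_on w (edges_on V)" using set by (simp add: distinct_map)
  from min_spanning_tree_unspanned[OF fin this T] show ?thesis
    using kruskal_sorted[of gs V w] sorted set by simp
qed

section \<open>The order of independent atomless variables\<close>

lemma pred_sorted_wrt_less:
  fixes X :: "'i \<Rightarrow> 'a \<Rightarrow> real"
  assumes "\<And>i. i \<in> set xs \<Longrightarrow> X i \<in> borel_measurable M"
  shows "Measurable.pred M (\<lambda>\<omega>. sorted_wrt (\<lambda>a b. X a \<omega> < X b \<omega>) xs)"
  using assms
proof (induction xs)
  case (Cons x xs)
  have "Measurable.pred M (\<lambda>\<omega>. X x \<omega> < X y \<omega>)" if "y \<in> set xs" for y
  proof -
    have [measurable]: "X x \<in> borel_measurable M" "X y \<in> borel_measurable M"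
      using Cons.prems that by auto
    show ?thesis by measurable
  qed
  then have "Measurable.pred M (\<lambda>\<omega>. \<forall>y\<in>set xs. X x \<omega> < X y \<omega>)"
    by (intro pred_intros_finite) auto
  then show ?case using Cons by (simp add: pred_intros_logic)
qed simp

context prob_space
begin

lemma indep_sets_reindex:
  assumes "indep_sets F I" "inj_on f J" "f ` J \<subseteq> I"
  shows "indep_sets (\<lambda>j. F (f j)) J"
  unfolding indep_sets_def
proof (intro conjI ballI allI impI)
  fix j assume "j \<in> J"
  then show "F (f j) \<subseteq> events" using assms by (auto simp: indep_sets_def)
next
  fix K A assume K: "K \<subseteq> J" "K \<noteq> {}" "finite K" and A: "A \<in> Pi K (\<lambda>j. F (f j))"
  have inj: "inj_on f K" using assms(2) K(1) by (rule inj_on_subset)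
  define B where "B = (\<lambda>i. A (the_inv_into K f i))"
  have B: "B (f k) = A k" if "k \<in> K" for k using that inj by (simp add: B_def the_inv_into_f_f)
  have "prob (\<Inter>i\<in>f ` K. B i) = (\<Prod>i\<in>f ` K. prob (B i))"
    using assms(1,3) K A B by (intro indep_setsD[of F I]) (auto simp: Pi_iff)
  then show "prob (\<Inter>j\<in>K. A j) = (\<Prod>j\<in>K. prob (A j))"
    using B by (simp add: prod.reindex[OF inj] cong: INF_cong)
qed

text \<open>Serves two purposes: extracting a pair of variables, indexed by \<open>bool\<close>, and
  permuting the whole family.\<close>

lemma indep_vars_reindex:
  assumes "indep_vars N X I" "inj_on f J" "f ` J \<subseteq> I"
  shows "indep_vars (\<lambda>j. N (f j)) (\<lambda>j. X (f j)) J"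
proof -
  have "random_variable (N (f j)) (X (f j))" if "j \<in> J" for j
    using assms(1,3) that unfolding indep_vars_def2 by blast
  moreover have "indep_sets (\<lambda>j. {X (f j) -` A \<inter> space M |A. A \<in> sets (N (f j))}) J"
    using assms(1) unfolding indep_vars_def2 by (intro indep_sets_reindex[OF _ assms(2,3)]) blast
  ultimately show ?thesis unfolding indep_vars_def2 by blast
qed

text \<open>By independence the joint law is a product, and every section of the diagonal is a
  single point, null for the law of \<open>Y\<close>.\<close>

lemma AE_neq_of_indep_atomless:
  fixes X Y :: "'a \<Rightarrow> real"
  assumes ind: "indep_var borel X borel Y" and atom: "\<And>x. measure (distr M borel Y) {x} = 0"
  shows "AE \<omega> in M. X \<omega> \<noteq> Y \<omega>"
proof -
  have [measurable]: "X \<in> borel_measurable M" "Y \<in> borel_measurable M"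
    using ind by (auto dest: indep_var_rv1 indep_var_rv2)
  interpret X: prob_space "distr M borel X" by (rule prob_space_distr) simp
  interpret Y: prob_space "distr M borel Y" by (rule prob_space_distr) simp
  interpret P: pair_sigma_finite "distr M borel X" "distr M borel Y" ..
  have "AE y in distr M borel Y. x \<noteq> y" for x
    using atom[of x] by (intro AE_I[of _ _ "{x}"]) (auto simp: Y.emeasure_eq_measure)
  moreover have "{p \<in> space (borel \<Otimes>\<^sub>M borel). fst p \<noteq> snd p} \<in> sets (borel \<Otimes>\<^sub>M borel :: (real \<times> real) measure)"
    by measurable
  then have "{p \<in> space (distr M borel X \<Otimes>\<^sub>M distr M borel Y). fst p \<noteq> snd p} \<in> sets (distr M borel X \<Otimes>\<^sub>M distr M borel Y)"
    by (simp add: space_pair_measure cong: sets_pair_measure_cong)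
  ultimately have "AE p in distr M borel X \<Otimes>\<^sub>M distr M borel Y. fst p \<noteq> snd p"
    by (intro P.AE_pair_measure) auto
  then have "AE p in distr M (borel \<Otimes>\<^sub>M borel) (\<lambda>\<omega>. (X \<omega>, Y \<omega>)). fst p \<noteq> snd p"
    using ind unfolding indep_var_distribution_eq by (simp only:)
  from AE_distrD[OF _ this] show ?thesis by simp
qed

context
  fixes X :: "'i \<Rightarrow> 'a \<Rightarrow> real" and I :: "'i set" and \<mu> :: "real measure"
  assumes fin: "finite I" and ind: "indep_vars (\<lambda>_. borel) X I"
    and law: "\<forall>i\<in>I. distr M borel (X i) = \<mu>"
    and atomless: "\<And>x. measure \<mu> {x} = 0"
begin

lemma measurable_X: "i \<in> I \<Longrightarrow> X i \<in> borel_measurable M"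
  by (rule bspec[OF ind[unfolded indep_vars_def2, THEN conjunct1]])

lemma AE_inj_on: "AE \<omega> in M. inj_on (\<lambda>i. X i \<omega>) I"
proof -
  have "AE \<omega> in M. i \<noteq> j \<longrightarrow> X i \<omega> \<noteq> X j \<omega>" if ij: "i \<in> I" "j \<in> I" for i j
  proof (cases "i = j")
    case False
    have "indep_vars (\<lambda>_. borel) (\<lambda>b. X (case_bool i j b)) UNIV"
      using False ij by (intro indep_vars_reindex[OF ind]) (auto simp: inj_on_def split: bool.splits)
    moreover have "(\<lambda>b. X (case_bool i j b)) = case_bool (X i) (X j)"
      by (auto split: bool.split)
    moreover have "(\<lambda>_::bool. borel :: real measure) = case_bool borel borel"
      by (auto split: bool.split)
    ultimately have "indep_var borel (X i) borel (X j)" by (simp add: indep_var_def)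
    moreover have "measure (distr M borel (X j)) {x} = 0" for x
      by (simp only: law[rule_format, OF ij(2)] atomless)
    ultimately have "AE \<omega> in M. X i \<omega> \<noteq> X j \<omega>" by (rule AE_neq_of_indep_atomless)
    then show ?thesis by auto
  qed simp
  then have "AE \<omega> in M. \<forall>i\<in>I. \<forall>j\<in>I. i \<noteq> j \<longrightarrow> X i \<omega> \<noteq> X j \<omega>"
    by (intro AE_finite_allI fin)
  then show ?thesis by eventually_elim (auto simp: inj_on_def)
qed

text \<open>Exchangeability: the right side is free of \<pi>, so all permuted families have one
  joint law.\<close>

lemma joint_law_reindex:
  assumes ne: "I \<noteq> {}" and \<pi>: "inj_on \<pi> I" "\<pi> ` I \<subseteq> I"
  shows "distr M (PiM I (\<lambda>_. borel)) (\<lambda>\<omega>. \<lambda>i\<in>I. X (\<pi> i) \<omega>) = PiM I (\<lambda>_. \<mu>)"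
proof -
  have "indep_vars (\<lambda>_. borel) (\<lambda>i. X (\<pi> i)) I" by (rule indep_vars_reindex[OF ind \<pi>])
  then have "distr M (PiM I (\<lambda>_. borel)) (\<lambda>\<omega>. \<lambda>i\<in>I. X (\<pi> i) \<omega>) = PiM I (\<lambda>i. distr M borel (X (\<pi> i)))"
    using \<pi>(2) measurable_X by (subst (asm) indep_vars_iff_distr_eq_PiM'[OF ne]) auto
  also have "\<dots> = PiM I (\<lambda>_. \<mu>)" using \<pi>(2) law by (intro PiM_cong) auto
  finally show ?thesis .
qed

abbreviation (input) "sorted_event xs \<equiv> {\<omega> \<in> space M. sorted_wrt (\<lambda>a b. X a \<omega> < X b \<omega>) xs}"

lemma sorted_event_measurable:
  assumes "set xs \<subseteq> I"
  shows "sorted_event xs \<in> events"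
proof -
  have "Measurable.pred M (\<lambda>\<omega>. sorted_wrt (\<lambda>a b. X a \<omega> < X b \<omega>) xs)"
    using assms measurable_X by (intro pred_sorted_wrt_less) auto
  then show ?thesis by simp
qed

text \<open>Let \<pi> send the i-th entry of \<open>xs\<close> to the i-th entry of
  \<open>ys\<close>. Being sorted along \<open>ys\<close> then means that the family permuted by
  \<pi> is sorted along \<open>xs\<close>, and permuting does not change the joint law.\<close>

lemma prob_sorted_eq:
  assumes xs: "xs \<in> permutations_of_set I" and ys: "ys \<in> permutations_of_set I" and ne: "I \<noteq> {}"
  shows "prob (sorted_event xs) = prob (sorted_event ys)"
proof -
  have len: "length xs = length ys" and dx: "distinct xs" and sx: "set xs = I" and sy: "set ys = I"
    using xs ys by (auto simp: permutations_of_set_def length_finite_permutations_of_set)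
  define \<pi> where "\<pi> = (\<lambda>x. ys ! inv_into {..<length xs} ((!) xs) x)"
  have map: "map \<pi> xs = ys"
    using dx len by (intro nth_equalityI) (auto simp: \<pi>_def inv_into_f_f inj_on_nth)
  have im: "\<pi> ` I = I" using arg_cong[OF map, of set] sx sy by simp
  then have inj: "inj_on \<pi> I" using fin by (intro eq_card_imp_inj_on) simp_all
  let ?P = "PiM I (\<lambda>_. borel :: real measure)"
  let ?A = "{w \<in> space ?P. sorted_wrt (\<lambda>a b. w a < w b) xs}"
  have "Measurable.pred ?P (\<lambda>w. sorted_wrt (\<lambda>a b. w a < w b) xs)"
    using sx by (intro pred_sorted_wrt_less measurable_component_singleton) simp
  then have A: "?A \<in> sets ?P" by simp
  have P: "prob {\<omega> \<in> space M. sorted_wrt (\<lambda>a b. X (\<rho> a) \<omega> < X (\<rho> b) \<omega>) xs} = measure (PiM I (\<lambda>_. \<mu>)) ?A"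
    if \<rho>: "inj_on \<rho> I" "\<rho> ` I \<subseteq> I" for \<rho>
  proof -
    have m: "(\<lambda>\<omega>. \<lambda>i\<in>I. X (\<rho> i) \<omega>) \<in> measurable M ?P"
      using \<rho>(2) measurable_X by (intro measurable_restrict) auto
    have "sorted_wrt (\<lambda>a b. (\<lambda>i\<in>I. X (\<rho> i) \<omega>) a < (\<lambda>i\<in>I. X (\<rho> i) \<omega>) b) xs \<longleftrightarrow>
        sorted_wrt (\<lambda>a b. X (\<rho> a) \<omega> < X (\<rho> b) \<omega>) xs" for \<omega>
      using sx by (auto simp: sorted_wrt_iff_nth_less)
    then have "(\<lambda>\<omega>. \<lambda>i\<in>I. X (\<rho> i) \<omega>) -` ?A \<inter> space M = {\<omega> \<in> space M. sorted_wrt (\<lambda>a b. X (\<rho> a) \<omega> < X (\<rho> b) \<omega>) xs}"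
      using measurable_space[OF m] by auto
    then show ?thesis
      unfolding joint_law_reindex[OF ne \<rho>, symmetric] measure_distr[OF m A] by simp
  qed
  have "sorted_wrt (\<lambda>a b. X a \<omega> < X b \<omega>) ys \<longleftrightarrow> sorted_wrt (\<lambda>a b. X (\<pi> a) \<omega> < X (\<pi> b) \<omega>) xs" for \<omega>
    unfolding map[symmetric] sorted_wrt_map ..
  then show ?thesis using P[of "\<lambda>x. x"] P[of \<pi>] inj im by simp
qed

lemma sorted_permutation_unique:
  assumes "xs \<in> permutations_of_set I" "ys \<in> permutations_of_set I"
    and "sorted_wrt (\<lambda>a b. X a \<omega> < X b \<omega>) xs" "sorted_wrt (\<lambda>a b. X a \<omega> < X b \<omega>) ys"
  shows "xs = ys"
proof -
  have st: "set xs = I" "set ys = I" using assms by (auto simp: permutations_of_set_def)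
  have s: "sorted_wrt (<) (map (\<lambda>i. X i \<omega>) xs)" "sorted_wrt (<) (map (\<lambda>i. X i \<omega>) ys)"
    using assms by (simp_all add: sorted_wrt_map)
  then have "map (\<lambda>i. X i \<omega>) xs = map (\<lambda>i. X i \<omega>) ys"
    using st by (intro strict_sorted_equal) simp_all
  moreover have "inj_on (\<lambda>i. X i \<omega>) (set xs \<union> set ys)"
    using s(1) st by (simp add: strict_sorted_iff distinct_map)
  ultimately show ?thesis by (simp add: inj_on_map_eq_map)
qed

lemma ex_sorted_permutation:
  assumes inj: "inj_on (\<lambda>i. X i \<omega>) I"
  shows "\<exists>xs\<in>permutations_of_set I. sorted_wrt (\<lambda>a b. X a \<omega> < X b \<omega>) xs"
proof -
  obtain ys where ys: "set ys = I" "distinct ys" using finite_distinct_list[OF fin] by blast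
  let ?xs = "sort_key (\<lambda>i. X i \<omega>) ys"
  have "distinct (map (\<lambda>i. X i \<omega>) ?xs)" using ys inj by (simp add: distinct_map)
  then have "sorted_wrt (<) (map (\<lambda>i. X i \<omega>) ?xs)" by (simp add: strict_sorted_iff)
  then have "sorted_wrt (\<lambda>a b. X a \<omega> < X b \<omega>) ?xs" by (simp add: sorted_wrt_map)
  then show ?thesis using ys by (intro bexI[of _ ?xs]) (simp_all add: permutations_of_set_def)
qed

lemma prob_sorted_Union:
  assumes L: "L \<subseteq> permutations_of_set I"
  shows "prob (\<Union>xs\<in>L. sorted_event xs) = (\<Sum>xs\<in>L. prob (sorted_event xs))"
proof (rule finite_measure_finite_Union)
  show "finite L" using L by (rule finite_subset) simp
  show "(\<lambda>xs. sorted_event xs) ` L \<subseteq> events"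
    using L by (auto intro!: sorted_event_measurable dest: permutations_of_setD)
  show "disjoint_family_on (\<lambda>xs. sorted_event xs) L"
    unfolding disjoint_family_on_def
  proof (intro ballI impI)
    fix xs ys assume "xs \<in> L" "ys \<in> L" "xs \<noteq> ys"
    then show "sorted_event xs \<inter> sorted_event ys = {}"
      using L sorted_permutation_unique[of xs ys] by blast
  qed
qed

text \<open>The sorting events of the different orders are disjoint, equally likely and, since ties
  are null, almost surely exhaustive.\<close>

lemma prob_sorted:
  assumes xs: "xs \<in> permutations_of_set I"
  shows "prob (sorted_event xs) = 1 / fact (card I)"
proof (cases "I = {}")
  case True
  with xs show ?thesis by (simp add: prob_space)
next
  case False
  let ?L = "permutations_of_set I"
  have "AE \<omega> in M. \<omega> \<in> (\<Union>xs\<in>?L. sorted_event xs)"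
    using AE_inj_on AE_space by eventually_elim (use ex_sorted_permutation in auto)
  moreover have "(\<Union>xs\<in>?L. sorted_event xs) \<in> events"
    by (intro sets.finite_UN sorted_event_measurable) (auto dest: permutations_of_setD)
  ultimately have "1 = prob (\<Union>xs\<in>?L. sorted_event xs)" by (simp add: prob_eq_1)
  also have "\<dots> = (\<Sum>ys\<in>?L. prob (sorted_event ys))" by (rule prob_sorted_Union) simp
  also have "\<dots> = (\<Sum>ys\<in>?L. prob (sorted_event xs))"
    using prob_sorted_eq[OF _ xs False] by (intro sum.cong) auto
  also have "\<dots> = fact (card I) * prob (sorted_event xs)" using fin by simp
  finally show ?thesis by (simp add: field_simps)
qed

text \<open>Turns a probability into a count of orders. \<open>P\<close> is prescribed only where
  the variables are strictly sorted; its values on ties are arbitrary, so measurability is a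
  hypothesis of its own.\<close>

lemma prob_order_event:
  assumes Q: "{\<omega> \<in> space M. P \<omega>} \<in> events"
    and eq: "\<And>xs \<omega>. xs \<in> permutations_of_set I \<Longrightarrow> \<omega> \<in> sorted_event xs \<Longrightarrow> P \<omega> \<longleftrightarrow> R xs"
  shows "prob {\<omega> \<in> space M. P \<omega>} = real (card {xs \<in> permutations_of_set I. R xs}) / fact (card I)"
proof -
  let ?L = "{xs \<in> permutations_of_set I. R xs}"
  have ev: "(\<Union>xs\<in>?L. sorted_event xs) \<in> events"
    by (intro sets.finite_UN sorted_event_measurable) (auto dest: permutations_of_setD)
  have "AE \<omega> in M. \<omega> \<in> {\<omega> \<in> space M. P \<omega>} \<longleftrightarrow> \<omega> \<in> (\<Union>xs\<in>?L. sorted_event xs)"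
    using AE_inj_on AE_space
  proof eventually_elim
    case (elim \<omega>)
    then obtain xs where xs: "xs \<in> permutations_of_set I" "\<omega> \<in> sorted_event xs"
      using ex_sorted_permutation by blast
    have unique: "ys = xs" if "ys \<in> permutations_of_set I" "\<omega> \<in> sorted_event ys" for ys
      using that xs sorted_permutation_unique[of ys xs \<omega>] by simp
    have iff: "P \<omega> \<longleftrightarrow> R xs" by (rule eq[OF xs])
    show ?case
    proof
      assume "\<omega> \<in> {\<omega> \<in> space M. P \<omega>}"
      then have "xs \<in> ?L" using iff xs(1) by simp
      then show "\<omega> \<in> (\<Union>xs\<in>?L. sorted_event xs)" using xs(2) by (rule UN_I)
    next
      assume "\<omega> \<in> (\<Union>xs\<in>?L. sorted_event xs)"
      then obtain ys where "ys \<in> ?L" "\<omega> \<in> sorted_event ys" by blast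
      then show "\<omega> \<in> {\<omega> \<in> space M. P \<omega>}" using iff unique[of ys] xs(2) by simp
    qed
  qed
  then have "prob {\<omega> \<in> space M. P \<omega>} = prob (\<Union>xs\<in>?L. sorted_event xs)"
    using Q ev by (rule finite_measure_eq_AE)
  also have "\<dots> = (\<Sum>xs\<in>?L. prob (sorted_event xs))" by (rule prob_sorted_Union) auto
  also have "\<dots> = (\<Sum>xs\<in>?L. 1 / fact (card I))"
    by (intro sum.cong refl prob_sorted) simp
  finally show ?thesis by simp
qed

end

end

section \<open>The complete graph with random weights\<close>

lemma complete_graph_edges_on: "complete_graph_edges n = edges_on {..<n}"
  by (simp add: complete_graph_edges_def edges_on_def)

lemma complete_graph_mst_kruskal:
  assumes gs: "gs \<in> permutations_of_set (complete_graph_edges n)"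
    and sorted: "sorted_wrt (\<lambda>a b. w a < w b) gs"
  shows "complete_graph_mst n w = kruskal {} gs"
proof -
  have "distinct (map w gs)" using sorted by (simp add: sorted_wrt_map[symmetric] strict_sorted_iff)
  then have "inj_on w (edges_on {..<n})"
    using gs by (simp add: distinct_map permutations_of_set_def complete_graph_edges_on)
  then have "is_min_spanning_tree {..<n} (edges_on {..<n}) w (complete_graph_mst n w)"
    unfolding complete_graph_mst_def complete_graph_edges_on
    by (rule theI'[OF ex1_min_spanning_tree[OF finite_lessThan]])
  then show ?thesis
    using gs sorted unfolding complete_graph_edges_on by (intro min_spanning_tree_kruskal[OF finite_lessThan])
qed

text \<open>The tree is measurable even on the null event where \<open>THE\<close> is unspecified, since it is
  determined by the set of minimum spanning trees.\<close>

lemma complete_graph_mst_measurable: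
  assumes W: "\<And>g. g \<in> complete_graph_edges n \<Longrightarrow> W g \<in> borel_measurable M"
  shows "{\<omega> \<in> space M. P (complete_graph_mst n (\<lambda>g. W g \<omega>))} \<in> sets M"
proof -
  let ?E = "complete_graph_edges n"
  let ?mst = "\<lambda>\<omega> T. is_min_spanning_tree {..<n} ?E (\<lambda>g. W g \<omega>) T"
  let ?trees = "{S. is_spanning_tree {..<n} ?E S}"
  have finE: "finite ?E" by (simp add: complete_graph_edges_on finite_edges_on)
  have trees: "?trees \<subseteq> Pow ?E" by (auto simp: is_spanning_tree_def)
  then have fin: "finite ?trees" by (rule finite_subset) (simp add: finE)
  have s: "(\<lambda>\<omega>. \<Sum>g\<in>S. W g \<omega>) \<in> borel_measurable M" if "S \<in> ?trees" for S
    using that trees W by (intro borel_measurable_sum) auto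
  have m: "Measurable.pred M (\<lambda>\<omega>. ?mst \<omega> T)" for T
  proof (cases "T \<in> ?trees")
    case True
    have "Measurable.pred M (\<lambda>\<omega>. (\<Sum>g\<in>T. W g \<omega>) \<le> (\<Sum>g\<in>S. W g \<omega>))" if "S \<in> ?trees" for S
      unfolding pred_def using s[OF True] s[OF that] by (rule borel_measurable_le)
    then have "Measurable.pred M (\<lambda>\<omega>. \<forall>S\<in>?trees. (\<Sum>g\<in>T. W g \<omega>) \<le> (\<Sum>g\<in>S. W g \<omega>))"
      by (intro pred_intros_finite fin)
    then show ?thesis using True by (simp add: is_min_spanning_tree_def)
  qed (simp add: is_min_spanning_tree_def)
  \<comment> \<open>\<open>A\<close> runs through the finitely many candidates for the set of all
    minimum spanning trees. For a fixed \<open>A\<close> the \<open>THE\<close> term is a constant,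
    so only the comparisons between tree weights depend on \<omega>.\<close>
  have *: "P (complete_graph_mst n (\<lambda>g. W g \<omega>)) \<longleftrightarrow>
      (\<exists>A\<in>{A \<in> Pow ?trees. P (THE T. T \<in> A)}. \<forall>T\<in>?trees. ?mst \<omega> T \<longleftrightarrow> T \<in> A)" (is "_ \<longleftrightarrow> ?R") for \<omega>
  proof -
    have sub: "{T. ?mst \<omega> T} \<subseteq> ?trees" by (auto simp: is_min_spanning_tree_def)
    have the: "complete_graph_mst n (\<lambda>g. W g \<omega>) = (THE T. T \<in> {T. ?mst \<omega> T})"
      by (simp add: complete_graph_mst_def)
    have "A = {T. ?mst \<omega> T}" if "A \<subseteq> ?trees" "\<forall>T\<in>?trees. ?mst \<omega> T \<longleftrightarrow> T \<in> A" for A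
      using that sub by blast
    then show ?thesis unfolding the using sub by blast
  qed
  have "Measurable.pred M (\<lambda>\<omega>. \<exists>A\<in>{A \<in> Pow ?trees. P (THE T. T \<in> A)}. \<forall>T\<in>?trees. ?mst \<omega> T \<longleftrightarrow> T \<in> A)"
    using fin m by (intro pred_intros_finite pred_intros_logic) auto
  then show ?thesis unfolding * by simp
qed

theorem theoremB2:
  fixes n :: nat
    and e f :: "nat set"
    and M :: "'w measure"
    and W :: "nat set \<Rightarrow> 'w \<Rightarrow> real"
    and \<mu> :: "real measure"
    and T :: "'w \<Rightarrow> nat set set"
    and p0 p2 :: real
  assumes "4 \<le> n"
    and "e \<in> complete_graph_edges n"
    and "f \<in> complete_graph_edges n"
    and "e \<inter> f = {}"
    and "prob_space M"
    and "prob_space.indep_vars M (\<lambda>_. borel) W (complete_graph_edges n)"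
    and "\<And>g. g \<in> complete_graph_edges n \<Longrightarrow> distr M borel (W g) = \<mu>"
    and "\<And>x. measure \<mu> {x} = 0"
    and "T = (\<lambda>\<omega>. complete_graph_mst n (\<lambda>g. W g \<omega>))"
    and "p0 = \<P>(\<omega> in M. e \<in> T \<omega>)"
    and "p2 = \<P>(\<omega> in M. e \<in> T \<omega> \<and> f \<in> T \<omega>)"
  shows "(AE \<omega> in M. \<exists>!S. is_min_spanning_tree {..<n} (complete_graph_edges n) (\<lambda>g. W g \<omega>) S)
    \<and> p0 = 2 / real n
    \<and> p2 < p0\<^sup>2
    \<and> p0\<^sup>2 = 4 / (real n)\<^sup>2"
proof -
  interpret prob_space M by fact
  let ?E = "complete_graph_edges n" and ?V = "{..<n}"
  have E: "?E = edges_on ?V" by (rule complete_graph_edges_on)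
  have finE: "finite ?E" by (simp add: E finite_edges_on)
  have law: "\<forall>g\<in>?E. distr M borel (W g) = \<mu>" using assms(7) by blast
  note iid = finE assms(6) law assms(8)
  have W: "W g \<in> borel_measurable M" if "g \<in> ?E" for g
    using that assms(6) by (auto simp: indep_vars_def)
  have unique: "AE \<omega> in M. \<exists>!S. is_min_spanning_tree ?V ?E (\<lambda>g. W g \<omega>) S"
    using AE_inj_on[OF iid] by eventually_elim (simp add: E ex1_min_spanning_tree)
  \<comment> \<open>The identification is claimed on strictly sorted weights; the remaining event,
    that of ties, is null.\<close>
  have T: "T \<omega> = kruskal {} gs"
    if "gs \<in> permutations_of_set ?E" "\<omega> \<in> {\<omega> \<in> space M. sorted_wrt (\<lambda>a b. W a \<omega> < W b \<omega>) gs}" for gs \<omega>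
    using that complete_graph_mst_kruskal[of gs n "\<lambda>g. W g \<omega>"] by (simp add: assms(9))
  have "p0 = real (card {gs \<in> permutations_of_set ?E. e \<in> kruskal {} gs}) / fact (card ?E)"
    unfolding assms(10)
  proof (rule prob_order_event[OF iid])
    show "{\<omega> \<in> space M. e \<in> T \<omega>} \<in> events"
      unfolding assms(9) by (rule complete_graph_mst_measurable[OF W])
  qed (simp only: T)
  also have "\<dots> = 2 / real n"
    using kruskal_edge_count[of ?V e] assms(2) by (simp add: E)
  finally have p0: "p0 = 2 / real n" .
  have "p2 = real (card {gs \<in> permutations_of_set ?E. e \<in> kruskal {} gs \<and> f \<in> kruskal {} gs}) / fact (card ?E)"
    unfolding assms(11)
  proof (rule prob_order_event[OF iid])
    show "{\<omega> \<in> space M. e \<in> T \<omega> \<and> f \<in> T \<omega>} \<in> events"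
      unfolding assms(9) by (rule complete_graph_mst_measurable[OF W])
  qed (simp only: T)
  also have "\<dots> < 4 / (real n)\<^sup>2"
    using kruskal_disjoint_count[of ?V e f] assms(1-4) by (simp add: E pos_divide_less_eq)
  finally have "p2 < 4 / (real n)\<^sup>2" .
  then show ?thesis using unique p0 by (simp add: power_divide)
qed

end
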